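(* Let $K,F\subset\mathbb{R}^d$ be two dust-like self-similar sets with the same Hausdorff dimension $s$. If there is a Lipschitz map $f: K\to\mathbb{R}^d$ with $\mathcal{H}^s(f(K)\cap F)>0$, then there is a Lipschitz surjection from $K$ onto $F$.
   Context: A self-similar set $K\subset\mathbb{R}^d$ is the attractor (the unique non-empty compact set with $K=\bigcup_{i=1}^n\varphi_i(K)$) of a finite iterated function system (IFS) $\Phi=\{\varphi_i\}_{i=1}^n$, where each $\varphi_i:\mathbb{R}^d\to\mathbb{R}^d$ is a contractive similitude (i.e. $|\varphi_i(x)-\varphi_i(y)|=r_i|x-y|$ for all $x,y$, with contraction ratio $r_i\in(0,1)$). It is called dust-like if $n\ge 2$ and the images $\varphi_1(K),\dots,\varphi_n(K)$ are pairwise disjoint (the strong separation condition, SSC). $\mathcal{H}^s$ denotes the $s$-dimensional Hausdorff measure. *)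

theory Defs
  imports "HOL-Analysis.Analysis"
begin

text \<open>
  The term \<open>|U|\<^sup>s\<close> of a covering sum, for \<open>s \<ge> 0\<close>, with the usual conventions \<open>|{}|\<^sup>s = 0\<close> and
  \<open>0\<^sup>0 = 1\<close>; these have to be spelled out because \<open>0 powr 0 = 0\<close>. Only used for bounded \<open>U\<close>,
  since \<open>diameter\<close> is unspecified on unbounded sets.
\<close>

definition diameter_power :: "real \<Rightarrow> 'a::metric_space set \<Rightarrow> ennreal" where
  "diameter_power s U =
     (if U = {} then 0 else if s = 0 then 1 else ennreal (diameter U powr s))"

definition hausdorff_premeasure :: "real \<Rightarrow> real \<Rightarrow> 'a::metric_space set \<Rightarrow> ennreal" where
  "hausdorff_premeasure s \<delta> A =
     (INF U\<in>{U :: nat \<Rightarrow> 'a set. A \<subseteq> (\<Union>i. U i) \<and> (\<forall>i. bounded (U i) \<and> diameter (U i) \<le> \<delta>)}.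
        \<Sum>i. diameter_power s (U i))"

text \<open>
  The \<open>s\<close>-dimensional Hausdorff (outer) measure, without a normalising constant. As the premeasure
  is antitone in \<open>\<delta>\<close>, the supremum is its limit for \<open>\<delta> \<rightarrow> 0\<close>.
\<close>

definition hausdorff_measure :: "real \<Rightarrow> 'a::metric_space set \<Rightarrow> ennreal" where
  "hausdorff_measure s A = (SUP \<delta>\<in>{0<..}. hausdorff_premeasure s \<delta> A)"

definition hausdorff_dim :: "'a::metric_space set \<Rightarrow> ereal" where
  "hausdorff_dim A = (INF s\<in>{s. 0 \<le> s \<and> hausdorff_measure s A = 0}. ereal s)"

definition contractive_similitude :: "('a::metric_space \<Rightarrow> 'a) \<Rightarrow> bool" where
  "contractive_similitude \<phi> \<longleftrightarrow> (\<exists>r. 0 < r \<and> r < 1 \<and> (\<forall>x y. dist (\<phi> x) (\<phi> y) = r * dist x y))"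

text \<open>
  An IFS of \<open>n\<close> maps is given by \<open>\<phi> 0, \<dots>, \<phi> (n - 1)\<close>. The attractor is introduced as a predicate;
  lemma \<open>attractor_unique\<close> shows that at most one set satisfies it.
\<close>

definition is_attractor :: "nat \<Rightarrow> (nat \<Rightarrow> 'a::metric_space \<Rightarrow> 'a) \<Rightarrow> 'a set \<Rightarrow> bool" where
  "is_attractor n \<phi> K \<longleftrightarrow> K \<noteq> {} \<and> compact K \<and> K = (\<Union>i<n. \<phi> i ` K)"

definition dust_like :: "'a::metric_space set \<Rightarrow> bool" where
  "dust_like K \<longleftrightarrow>
     (\<exists>n \<phi>. 2 \<le> n \<and> (\<forall>i<n. contractive_similitude (\<phi> i)) \<and> is_attractor n \<phi> K \<and>
            disjoint_family_on (\<lambda>i. \<phi> i ` K) {..<n})"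

lemma attractor_subset:
  assumes sim: "\<forall>i<n. contractive_similitude (\<phi> i)"
    and K: "is_attractor n \<phi> K" and L: "is_attractor n \<phi> L"
  shows "K \<subseteq> L"
proof -
  have "continuous_on K (\<lambda>x. infdist x L)"
    by (intro continuous_intros)
  then obtain x where x: "x \<in> K" and max: "\<And>y. y \<in> K \<Longrightarrow> infdist y L \<le> infdist x L"
    using K continuous_attains_sup[of K "\<lambda>x. infdist x L"] unfolding is_attractor_def by blast
  obtain i y where i: "i < n" and y: "y \<in> K" and xy: "x = \<phi> i y"
    using x K unfolding is_attractor_def by blast
  obtain r where r: "0 < r" "r < 1" "\<And>u v. dist (\<phi> i u) (\<phi> i v) = r * dist u v"
    using sim i unfolding contractive_similitude_def by blast
  have "closed L" "L \<noteq> {}"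
    using L compact_imp_closed unfolding is_attractor_def by auto
  moreover have "compact L"
    using L unfolding is_attractor_def by auto
  moreover have "continuous_on L (dist y)"
    by (intro continuous_intros)
  ultimately obtain z where z: "z \<in> L" "\<And>w. w \<in> L \<Longrightarrow> dist y z \<le> dist y w"
    using continuous_attains_inf[of L "dist y"] by blast
  then have z': "infdist y L = dist y z"
    using \<open>L \<noteq> {}\<close> by (auto simp: infdist_notempty intro!: cINF_greatest antisym cINF_lower2 bdd_belowI2[of _ 0])
  have "\<phi> i z \<in> L"
    using z(1) i L unfolding is_attractor_def by blast
  then have "infdist x L \<le> r * infdist y L"
    using infdist_le[of "\<phi> i z" L x] r(3) xy z' by simp
  also have "\<dots> \<le> r * infdist x L"
    using max[OF y] r(1) by simp
  finally have "(1 - r) * infdist x L \<le> 0"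
    by (simp add: algebra_simps)
  then have "infdist x L \<le> 0"
    using r(2) by (simp add: mult_le_0_iff)
  then have "infdist u L = 0" if "u \<in> K" for u
    using max[OF that] infdist_nonneg[of u L] by linarith
  then show ?thesis
    using \<open>closed L\<close> \<open>L \<noteq> {}\<close> in_closed_iff_infdist_zero by blast
qed

lemma attractor_unique:
  assumes "\<forall>i<n. contractive_similitude (\<phi> i)" "is_attractor n \<phi> K" "is_attractor n \<phi> L"
  shows "K = L"
  using assms attractor_subset by (metis subset_antisym)

end

theory Submission
  imports Defs "HOL-Library.Sublist" "HOL-Complex_Analysis.Great_Picard"
begin

text \<open>
  A finite word over the indices of an IFS with attractor \<open>K\<close> stands for a composition of its maps; the
  image of \<open>K\<close> is a cylinder, a copy of \<open>K\<close> whose ratio is the product of the ratios of the letters.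
  That \<open>s\<close> is the dimension of \<open>K\<close> and \<open>F\<close> implies for their ratios that \<open>(\<Sum>i<n. r i powr s) \<le> 1\<close>
  (\<open>sum_ratio_powr_dim_le_1\<close>), so that the \<open>s\<close>-th power of the ratio serves as the mass of a cylinder:
  disjoint cylinders have a total mass of at most \<open>1\<close>.

  By strong separation \<open>K\<close> is ultrametric up to a constant factor, and closed subsets of ultrametric
  spaces are Lipschitz retracts (\<open>ex_lipschitz_retraction\<close>). Composing \<open>f\<close> with a retraction of \<open>K\<close> onto
  the preimage of \<open>F\<close> reduces the theorem to maps \<open>f\<close> from \<open>K\<close> into \<open>F\<close> whose image has positive
  measure.

  The idea is then to zoom in at a cylinder of \<open>F\<close> in which \<open>f ` K\<close> is nearly dense, and to pass to the
  limit. Zooming in would be of no use if more and more small cylinders of \<open>K\<close> were needed to cover the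
  preimage of the cylinder of \<open>F\<close>. But since \<open>K\<close> has mass at most \<open>1\<close>, the cylinders of \<open>F\<close> that need
  more than \<open>M\<close> cylinders of \<open>K\<close> of about their size have a total mass that tends to \<open>0\<close> for large \<open>M\<close>
  (\<open>weight_of_crowded_le\<close>), whereas covers of \<open>f ` K\<close> have a mass bounded away from \<open>0\<close>
  (\<open>cylinder_content_pos\<close>). So with \<open>M\<close> fixed there is for every \<open>k\<close> a cylinder of \<open>F\<close> all of whose
  descendants of generation \<open>k\<close> meet \<open>f ` K\<close>, while at most \<open>M\<close> cylinders of \<open>K\<close> are needed
  (\<open>ex_cyl_with_dense_trace\<close>).

  These at most \<open>M\<close> copies of \<open>K\<close> can be placed in disjoint cylinders of \<open>K\<close> of a fixed generation
  (\<open>ex_rescaled_map\<close>). Thus there are maps from \<open>K\<close> to \<open>F\<close> with a common Lipschitz constant, the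
  \<open>k\<close>-th of which meets all cylinders of generation \<open>k\<close> of \<open>F\<close>. By the Arzela-Ascoli theorem a
  subsequence converges uniformly, and its limit is onto (\<open>lipschitz_onto_limit\<close>).
\<close>

section \<open>Weights of words\<close>

(* Membership in lists is to be decided by splitting a word, not letter by letter. *)
declare in_listsD [rule del] in_listsI [rule del]

definition weight :: "('i \<Rightarrow> real) \<Rightarrow> 'i list \<Rightarrow> real" where
  "weight p w = prod_list (map p w)"

definition level :: "'i set \<Rightarrow> nat \<Rightarrow> 'i list set" where
  "level A N = {w \<in> lists A. length w = N}"

lemma weight_simps [simp]:
  "weight p [] = 1" "weight p (i # w) = p i * weight p w"
  "weight p (v @ w) = weight p v * weight p w"
  by (simp_all add: weight_def)

lemma weight_pos: "(\<And>i. i \<in> A \<Longrightarrow> 0 < p i) \<Longrightarrow> w \<in> lists A \<Longrightarrow> 0 < weight p w"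
  by (induction w) auto

lemma weight_powr:
  "(\<And>i. i \<in> A \<Longrightarrow> 0 < p i) \<Longrightarrow> w \<in> lists A \<Longrightarrow> weight p w powr u = weight (\<lambda>i. p i powr u) w"
  by (induction w) (auto simp: powr_mult weight_pos less_imp_le)

lemma finite_level: "finite A \<Longrightarrow> finite (level A N)"
  using finite_lists_length_eq[of A N] by (simp add: level_def lists_eq_set)

lemma level_0 [simp]: "level A 0 = {[]}"
  by (auto simp: level_def)

lemma level_Suc: "level A (Suc N) = (\<lambda>(i, w). i # w) ` (A \<times> level A N)"
  by (auto simp: level_def length_Suc_conv image_iff)

lemma sum_weight_level: "(\<Sum>w\<in>level A N. weight p w) = (\<Sum>i\<in>A. p i) ^ N"
proof (induction N)
  case (Suc N)
  have "(\<Sum>w\<in>level A (Suc N). weight p w) = (\<Sum>(i, w)\<in>A \<times> level A N. p i * weight p w)"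
    unfolding level_Suc by (subst sum.reindex) (auto simp: inj_on_def case_prod_unfold)
  also have "\<dots> = (\<Sum>i\<in>A. p i) * (\<Sum>w\<in>level A N. weight p w)"
    by (simp add: sum_product sum.cartesian_product)
  finally show ?case
    using Suc by simp
qed simp

lemma sum_weight_extensions:
  "(\<Sum>v\<in>(@) w ` level A N. weight p v) = weight p w * (\<Sum>i\<in>A. p i) ^ N"
  by (subst sum.reindex) (auto simp: inj_on_def sum_distrib_left[symmetric] sum_weight_level)

text \<open>
  Kraft's inequality: the extensions to a common length \<open>N\<close> of words that are pairwise not
  prefixes of each other are pairwise different, and all words of length \<open>N\<close> together weigh
  \<open>(\<Sum>i\<in>A. p i) ^ N\<close>.
\<close>

lemma sum_weight_antichain_le_1:
  assumes A: "finite A" "A \<noteq> {}" "\<And>i. i \<in> A \<Longrightarrow> 0 < p i" "(\<Sum>i\<in>A. p i) \<le> 1"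
    and W: "finite W" "W \<subseteq> lists A"
    and anti: "\<And>v w. v \<in> W \<Longrightarrow> w \<in> W \<Longrightarrow> prefix v w \<Longrightarrow> v = w"
  shows "(\<Sum>w\<in>W. weight p w) \<le> 1"
proof -
  define S where "S = (\<Sum>i\<in>A. p i)"
  have S: "0 < S" "S \<le> 1"
    using A by (auto simp: S_def intro!: sum_pos)
  have pos: "0 \<le> weight p v" if "v \<in> lists A" for v
    by (rule less_imp_le, rule weight_pos[of A p]) (use that A(3) in auto)
  define N where "N = Max (length ` W)"
  have N: "length w \<le> N" if "w \<in> W" for w
    using that W(1) by (auto simp: N_def)
  define X where "X w = (@) w ` level A (N - length w)" for w
  have sub: "X w \<subseteq> level A N" if "w \<in> W" for w
    using N[OF that] subsetD[OF W(2) that] by (auto simp: X_def level_def)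
  have disj: "X v \<inter> X w = {}" if "v \<in> W" "w \<in> W" "v \<noteq> w" for v w
  proof -
    have "prefix v u \<and> prefix w u" if "u \<in> X v \<inter> X w" for u
      using that unfolding X_def by (metis IntE imageE prefixI)
    with anti[OF that(1,2)] anti[OF that(2,1)] that(3) show ?thesis
      using prefix_same_cases by blast
  qed
  have "(\<Sum>w\<in>W. weight p w) * S ^ N = (\<Sum>w\<in>W. weight p w * S ^ N)"
    by (rule sum_distrib_right)
  also have "\<dots> \<le> (\<Sum>w\<in>W. weight p w * S ^ (N - length w))"
    using S W(2) pos by (intro sum_mono mult_left_mono power_decreasing) auto
  also have "\<dots> = (\<Sum>w\<in>W. \<Sum>v\<in>X w. weight p v)"
    by (simp add: X_def sum_weight_extensions S_def)
  also have "\<dots> = (\<Sum>v\<in>(\<Union>w\<in>W. X w). weight p v)"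
    using W(1) finite_level[OF A(1)] disj by (subst sum.UNION_disjoint) (auto simp: X_def)
  also have "\<dots> \<le> (\<Sum>v\<in>level A N. weight p v)"
  proof (rule sum_mono2)
    show "finite (level A N)" by (rule finite_level[OF A(1)])
    show "(\<Union>w\<in>W. X w) \<subseteq> level A N" using sub by auto
    show "0 \<le> weight p v" if "v \<in> level A N - (\<Union>w\<in>W. X w)" for v
      using that pos by (auto simp: level_def)
  qed
  also have "\<dots> = S ^ N"
    by (simp add: sum_weight_level S_def)
  finally show ?thesis
    using S(1) by simp
qed

text \<open>
  The dual of Kraft's inequality: here the extensions of the words of \<open>W\<close> exhaust all words of
  length \<open>N\<close>, possibly with repetitions.
\<close>

lemma sum_weight_bar_ge_1:
  assumes A: "finite A" "\<And>i. i \<in> A \<Longrightarrow> 0 < p i" "1 \<le> (\<Sum>i\<in>A. p i)"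
    and W: "finite W" "W \<subseteq> lists A" "\<And>w. w \<in> W \<Longrightarrow> length w \<le> N"
    and bar: "\<And>v. v \<in> level A N \<Longrightarrow> \<exists>w\<in>W. prefix w v"
  shows "1 \<le> (\<Sum>w\<in>W. weight p w)"
proof -
  define S where "S = (\<Sum>i\<in>A. p i)"
  have S: "1 \<le> S"
    using A by (simp add: S_def)
  define X where "X w = (@) w ` level A (N - length w)" for w
  have fin: "finite (X w)" for w
    using finite_level[OF A(1)] by (auto simp: X_def)
  have pos: "0 \<le> weight p v" if "v \<in> lists A" for v
    by (rule less_imp_le, rule weight_pos[of A p]) (use that A(2) in auto)
  have sub: "level A N \<subseteq> (\<Union>w\<in>W. X w)"
  proof
    fix v assume v: "v \<in> level A N"
    then obtain w z where "w \<in> W" "v = w @ z"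
      using bar unfolding prefix_def by blast
    with v show "v \<in> (\<Union>w\<in>W. X w)"
      by (intro UN_I[of w]) (auto simp: X_def level_def)
  qed
  have "S ^ N = (\<Sum>v\<in>level A N. weight p v)"
    by (simp add: sum_weight_level S_def)
  also have "\<dots> \<le> (\<Sum>v\<in>(\<Union>w\<in>W. X w). weight p v)"
    using sub W fin pos by (intro sum_mono2) (auto simp: X_def level_def)
  also have "\<dots> \<le> (\<Sum>w\<in>W. \<Sum>v\<in>X w. weight p v)"
    using W(1,2)
  proof (induction W)
    case (insert w W)
    have "0 \<le> (\<Sum>v\<in>X w \<inter> \<Union> (X ` W). weight p v)"
      using insert.prems pos by (intro sum_nonneg) (auto simp: X_def level_def)
    then show ?case
      using insert fin sum.union_inter[of "X w" "\<Union> (X ` W)" "weight p"] by simp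
  qed simp
  also have "\<dots> = (\<Sum>w\<in>W. weight p w * S ^ (N - length w))"
    by (simp add: X_def sum_weight_extensions S_def)
  also have "\<dots> \<le> (\<Sum>w\<in>W. weight p w * S ^ N)"
    using S W(2) pos by (intro sum_mono mult_left_mono power_increasing) auto
  also have "\<dots> = (\<Sum>w\<in>W. weight p w) * S ^ N"
    by (rule sum_distrib_right[symmetric])
  finally show ?thesis
    using S by simp
qed

section \<open>Cylinders of a dust-like set\<close>

locale dust_like_ifs =
  fixes n :: nat and \<phi> :: "nat \<Rightarrow> 'a::heine_borel \<Rightarrow> 'a" and r :: "nat \<Rightarrow> real" and K :: "'a set"
  assumes two_maps: "2 \<le> n"
    and ratio: "\<And>i. i < n \<Longrightarrow> 0 < r i" "\<And>i. i < n \<Longrightarrow> r i < 1"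
    and dist_map: "\<And>i x y. i < n \<Longrightarrow> dist (\<phi> i x) (\<phi> i y) = r i * dist x y"
    and attractor: "is_attractor n \<phi> K"
    and disjoint: "disjoint_family_on (\<lambda>i. \<phi> i ` K) {..<n}"

lemma dust_likeE:
  assumes "dust_like K"
  obtains n \<phi> r where "dust_like_ifs n \<phi> r K"
proof -
  obtain n \<phi> where n: "2 \<le> n" "\<forall>i<n. contractive_similitude (\<phi> i)" "is_attractor n \<phi> K"
      "disjoint_family_on (\<lambda>i. \<phi> i ` K) {..<n}"
    using assms unfolding dust_like_def by blast
  then obtain r where "\<forall>i<n. 0 < r i \<and> r i < 1 \<and> (\<forall>x y. dist (\<phi> i x) (\<phi> i y) = r i * dist x y)"
    unfolding contractive_similitude_def by metis
  with n have "dust_like_ifs n \<phi> r K"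
    by unfold_locales auto
  then show ?thesis by (rule that)
qed

context dust_like_ifs
begin

abbreviation Words :: "nat list set" where
  "Words \<equiv> lists {..<n}"

definition cyl :: "nat list \<Rightarrow> 'a set" where
  "cyl w = foldr \<phi> w ` K"

definition rmin :: real where "rmin = Min (r ` {..<n})"
definition rmax :: real where "rmax = Max (r ` {..<n})"

lemma K_nonempty: "K \<noteq> {}" and K_compact: "compact K" and K_eq: "K = (\<Union>i<n. \<phi> i ` K)"
  using attractor unfolding is_attractor_def by auto

lemma rmin: "0 < rmin" "\<And>i. i < n \<Longrightarrow> rmin \<le> r i" "rmin \<le> 1"
proof -
  have ne: "r ` {..<n} \<noteq> {}" using two_maps by (auto simp: lessThan_empty_iff)
  show "0 < rmin" unfolding rmin_def using ne ratio by (subst Min_gr_iff) auto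
  show le: "\<And>i. i < n \<Longrightarrow> rmin \<le> r i" unfolding rmin_def by auto
  show "rmin \<le> 1" using le[of 0] ratio(2)[of 0] two_maps by auto
qed

lemma rmax: "0 < rmax" "\<And>i. i < n \<Longrightarrow> r i \<le> rmax" "rmax < 1"
proof -
  have ne: "r ` {..<n} \<noteq> {}" using two_maps by (auto simp: lessThan_empty_iff)
  show "rmax < 1" unfolding rmax_def using ne ratio by (subst Max_less_iff) auto
  show le: "\<And>i. i < n \<Longrightarrow> r i \<le> rmax" unfolding rmax_def by auto
  show "0 < rmax" using le[of 0] ratio(1)[of 0] two_maps by auto
qed

lemma rmax_power_small: "0 < e \<Longrightarrow> \<exists>m. rmax ^ m < e"
  using real_arch_pow_inv rmax(3) by blast

lemma weight_r_pos: "w \<in> Words \<Longrightarrow> 0 < weight r w"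
  by (rule weight_pos) (use ratio in auto)

lemma weight_r_le: "w \<in> Words \<Longrightarrow> weight r w \<le> rmax ^ length w"
proof (induction w)
  case (Cons i w)
  then show ?case
    using rmax weight_r_pos[of w] ratio(1)[of i] by (auto intro!: mult_mono)
qed simp

lemma weight_r_ge: "w \<in> Words \<Longrightarrow> rmin ^ length w \<le> weight r w"
proof (induction w)
  case (Cons i w)
  then show ?case
    using rmin weight_r_pos[of w] ratio(1)[of i] by (auto intro!: mult_mono)
qed simp

lemma weight_r_le_1: "w \<in> Words \<Longrightarrow> weight r w \<le> 1"
  using weight_r_le[of w] power_le_one[of rmax "length w"] rmax by simp

lemma dist_word: "w \<in> Words \<Longrightarrow> dist (foldr \<phi> w x) (foldr \<phi> w y) = weight r w * dist x y"
  by (induction w) (auto simp: dist_map)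

lemma inj_word:
  assumes "w \<in> Words"
  shows "inj (foldr \<phi> w)"
proof (rule injI)
  fix x y assume "foldr \<phi> w x = foldr \<phi> w y"
  then have "weight r w * dist x y = 0"
    using dist_word[OF assms, of x y] by simp
  then show "x = y"
    using weight_r_pos[OF assms] by simp
qed

lemma cyl_Nil [simp]: "cyl [] = K"
  by (simp add: cyl_def)

lemma cyl_append: "cyl (v @ w) = foldr \<phi> v ` cyl w"
  by (simp add: cyl_def image_image)

lemma cyl_Cons: "cyl (i # w) = \<phi> i ` cyl w"
  using cyl_append[of "[i]" w] by simp

lemma cyl_subset_K: "w \<in> Words \<Longrightarrow> cyl w \<subseteq> K"
proof (induction w)
  case (Cons i w)
  then have "cyl (i # w) \<subseteq> \<phi> i ` K" by (auto simp: cyl_Cons)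
  also have "\<dots> \<subseteq> K" using K_eq Cons.prems by auto
  finally show ?case .
qed simp

lemma cyl_append_subset: "w \<in> Words \<Longrightarrow> cyl (v @ w) \<subseteq> cyl v"
  unfolding cyl_append using cyl_subset_K[of w] by (auto simp: cyl_def)

lemma cyl_prefix_subset: "w \<in> Words \<Longrightarrow> prefix v w \<Longrightarrow> cyl w \<subseteq> cyl v"
  by (elim prefixE) (simp add: cyl_append_subset)

lemma cyl_nonempty [simp]: "cyl w \<noteq> {}"
  using K_nonempty by (simp add: cyl_def)

lemma cyl_child: "x \<in> cyl w \<Longrightarrow> \<exists>i<n. x \<in> cyl (w @ [i])"
proof -
  assume "x \<in> cyl w"
  then obtain y where "y \<in> K" "x = foldr \<phi> w y"
    by (auto simp: cyl_def)
  moreover from this obtain i where "i < n" "y \<in> \<phi> i ` K"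
    using K_eq by blast
  ultimately show ?thesis
    by (auto simp: cyl_append cyl_Cons)
qed

lemma cyl_extension: "x \<in> cyl w \<Longrightarrow> \<exists>v\<in>level {..<n} N. x \<in> cyl (w @ v)"
proof (induction N)
  case (Suc N)
  then obtain v where v: "v \<in> level {..<n} N" "x \<in> cyl (w @ v)" by auto
  then obtain i where "i < n" "x \<in> cyl (w @ v @ [i])"
    using cyl_child[of x "w @ v"] by auto
  moreover from this v have "v @ [i] \<in> level {..<n} (Suc N)"
    by (simp add: level_def)
  ultimately show ?case by blast
qed simp

lemma dist_cyl_le:
  assumes "w \<in> Words" "x \<in> cyl w" "y \<in> cyl w"
  shows "dist x y \<le> weight r w * diameter K"
proof -
  obtain a b where "a \<in> K" "b \<in> K" "x = foldr \<phi> w a" "y = foldr \<phi> w b"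
    using assms by (auto simp: cyl_def)
  moreover from this have "dist a b \<le> diameter K"
    using diameter_bounded_bound[OF compact_imp_bounded[OF K_compact]] by blast
  ultimately show ?thesis
    using dist_word[OF assms(1), of a b] weight_r_pos[OF assms(1)] by simp
qed

lemma diameter_K_nonneg: "0 \<le> diameter K"
  by (rule diameter_ge_0[OF compact_imp_bounded[OF K_compact]])

lemma diameter_cyl_le: "w \<in> Words \<Longrightarrow> diameter (cyl w) \<le> weight r w * diameter K"
  unfolding diameter_def[of "cyl w"] using dist_cyl_le[of w] by (auto intro!: cSUP_least)

lemma bounded_cyl: "w \<in> Words \<Longrightarrow> bounded (cyl w)"
  by (rule bounded_subset[OF compact_imp_bounded[OF K_compact] cyl_subset_K])

lemma ex_gap:
  "\<exists>d>0. \<forall>i<n. \<forall>j<n. i \<noteq> j \<longrightarrow> (\<forall>x\<in>\<phi> i ` K. \<forall>y\<in>\<phi> j ` K. d \<le> dist x y)"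
proof -
  have comp: "compact (\<phi> i ` K)" if "i < n" for i
  proof (rule compact_continuous_image[OF _ K_compact])
    have "(r i)-lipschitz_on K (\<phi> i)"
      using that ratio[of i] by (auto simp: lipschitz_on_def dist_map)
    then show "continuous_on K (\<phi> i)"
      by (rule lipschitz_on_continuous_on)
  qed
  have "\<exists>d>0. i \<noteq> j \<longrightarrow> (\<forall>x\<in>\<phi> i ` K. \<forall>y\<in>\<phi> j ` K. d \<le> dist x y)" if "i < n" "j < n" for i j
  proof (cases "i = j")
    case False
    then have "\<phi> i ` K \<inter> \<phi> j ` K = {}"
      using disjoint that unfolding disjoint_family_on_def by auto
    with comp that compact_imp_closed[OF comp] show ?thesis
      using separate_compact_closed[of "\<phi> i ` K" "\<phi> j ` K"] by fastforce
  qed (auto intro: exI[of _ 1])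
  then obtain d where d: "\<And>i j. i < n \<Longrightarrow> j < n \<Longrightarrow> 0 < d i j"
      "\<And>i j. i < n \<Longrightarrow> j < n \<Longrightarrow> i \<noteq> j \<longrightarrow> (\<forall>x\<in>\<phi> i ` K. \<forall>y\<in>\<phi> j ` K. d i j \<le> dist x y)"
    by metis
  define D where "D = (\<lambda>(i, j). d i j) ` ({..<n} \<times> {..<n})"
  have D: "finite D" "D \<noteq> {}"
    using two_maps by (auto simp: D_def lessThan_empty_iff)
  have "0 < Min D"
    using D d(1) by (subst Min_gr_iff) (auto simp: D_def)
  moreover have "Min D \<le> d i j" if "i < n" "j < n" for i j
    using that D by (intro Min_le) (auto simp: D_def)
  ultimately show ?thesis
    using d(2) by (meson order_trans)
qed

definition gap :: real where
  "gap = (SOME d. 0 < d \<and> (\<forall>i<n. \<forall>j<n. i \<noteq> j \<longrightarrow> (\<forall>x\<in>\<phi> i ` K. \<forall>y\<in>\<phi> j ` K. d \<le> dist x y)))"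

lemma gap_pos: "0 < gap"
  and gap_le: "\<And>i j x y. i < n \<Longrightarrow> j < n \<Longrightarrow> i \<noteq> j \<Longrightarrow> x \<in> \<phi> i ` K \<Longrightarrow> y \<in> \<phi> j ` K \<Longrightarrow> gap \<le> dist x y"
proof -
  have "0 < gap \<and> (\<forall>i<n. \<forall>j<n. i \<noteq> j \<longrightarrow> (\<forall>x\<in>\<phi> i ` K. \<forall>y\<in>\<phi> j ` K. gap \<le> dist x y))"
    unfolding gap_def by (rule someI_ex) (use ex_gap in blast)
  then show "0 < gap"
    and "\<And>i j x y. i < n \<Longrightarrow> j < n \<Longrightarrow> i \<noteq> j \<Longrightarrow> x \<in> \<phi> i ` K \<Longrightarrow> y \<in> \<phi> j ` K \<Longrightarrow> gap \<le> dist x y"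
    by blast+
qed

text \<open>
  Strong separation at all scales: the maps shrink the gap between the cylinders of generation \<open>1\<close> by
  the same factor as the cylinders.
\<close>

lemma in_cyl_if_close:
  "w \<in> Words \<Longrightarrow> x \<in> cyl w \<Longrightarrow> y \<in> K \<Longrightarrow> dist x y < gap * weight r w \<Longrightarrow> y \<in> cyl w"
proof (induction w arbitrary: x y)
  case (Cons i w)
  then have i: "i < n" and w: "w \<in> Words" by auto
  obtain x' where x': "x' \<in> cyl w" "x = \<phi> i x'"
    using Cons.prems by (auto simp: cyl_Cons)
  obtain j y' where y': "j < n" "y' \<in> K" "y = \<phi> j y'"
    using Cons.prems(3) K_eq by blast
  have "gap * weight r (i # w) \<le> gap"
    using mult_left_le[OF weight_r_le_1[OF Cons.prems(1)], of gap] gap_pos by simp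
  then have "j = i"
    using gap_le[OF i y'(1), of x y] x' y' Cons.prems(4) cyl_subset_K[OF w] by force
  have "r i * dist x' y' < r i * (gap * weight r w)"
    using Cons.prems(4) x' y' \<open>j = i\<close> i by (simp add: dist_map mult_ac)
  then have "dist x' y' < gap * weight r w"
    using ratio(1)[OF i] by simp
  then have "y' \<in> cyl w"
    using Cons.IH[OF w x'(1) y'(2)] by simp
  then show ?case
    using y' \<open>j = i\<close> by (simp add: cyl_Cons)
qed simp

lemma cyl_meet_prefix:
  assumes "v \<in> Words" "w \<in> Words" "x \<in> cyl v" "x \<in> cyl w"
  shows "prefix v w \<or> prefix w v"
proof (rule ccontr)
  assume "\<not> ?thesis"
  then have "v \<parallel> w" by (simp add: parallel_def)
  then obtain u i v' j w' where ij: "i \<noteq> j" and v: "v = u @ i # v'" and w: "w = u @ j # w'"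
    using parallel_decomp by blast
  have u: "u \<in> Words" "i < n" "j < n" "v' \<in> Words" "w' \<in> Words"
    using assms v w by auto
  obtain a b where a: "a \<in> cyl (i # v')" "x = foldr \<phi> u a" and b: "b \<in> cyl (j # w')" "x = foldr \<phi> u b"
    using assms(3,4) unfolding v w cyl_append by blast
  have "a = b" using a b inj_word[OF u(1)] by (metis injD)
  moreover have "a \<in> \<phi> i ` K" "b \<in> \<phi> j ` K"
    using a b u cyl_subset_K by (auto simp: cyl_Cons)
  ultimately have "gap \<le> 0"
    using gap_le[of i j a b] ij u by simp
  then show False using gap_pos by simp
qed

text \<open>
  The smallest cylinder around \<open>U \<inter> K\<close> is not much larger than \<open>U\<close>, because \<open>U\<close> reaches from one
  of its children to another. There is no smallest cylinder if \<open>U \<inter> K\<close> has at most one point, whence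
  the second alternative.
\<close>

lemma ex_comparable_cyl:
  assumes "0 < e"
  shows "\<exists>w\<in>Words. U \<inter> K \<subseteq> cyl w \<and>
    ((\<exists>x\<in>U \<inter> K. \<exists>y\<in>U \<inter> K. gap * weight r w \<le> dist x y) \<or> weight r w < e)"
proof (rule ccontr)
  assume no: "\<not> ?thesis"
  have "\<exists>w\<in>level {..<n} m. U \<inter> K \<subseteq> cyl w" for m
  proof (induction m)
    case (Suc m)
    then obtain w where w: "w \<in> level {..<n} m" "U \<inter> K \<subseteq> cyl w" by auto
    then have wW: "w \<in> Words" by (simp add: level_def)
    have "\<exists>i<n. U \<inter> K \<subseteq> cyl (w @ [i])"
    proof (rule ccontr)
      assume *: "\<not> ?thesis"
      have "0 < n"
        using two_maps by simp
      then obtain x where x: "x \<in> U \<inter> K"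
        using * by blast
      then obtain i where i: "i < n" "x \<in> cyl (w @ [i])"
        using w(2) cyl_child by blast
      then obtain y where y: "y \<in> U \<inter> K" "y \<notin> cyl (w @ [i])"
        using * by blast
      then obtain j where j: "j < n" "y \<in> cyl (w @ [j])"
        using w(2) cyl_child by blast
      obtain a b where a: "a \<in> \<phi> i ` K" "x = foldr \<phi> w a" and b: "b \<in> \<phi> j ` K" "y = foldr \<phi> w b"
        using i(2) j(2) by (auto simp: cyl_append cyl_Cons)
      have "i \<noteq> j" using y j by auto
      then have "gap * weight r w \<le> dist x y"
        using gap_le[OF i(1) j(1) _ a(1) b(1)] a b dist_word[OF wW] weight_r_pos[OF wW] by (simp add: mult.commute)
      then show False
        using no x y wW w(2) by blast
    qed
    then obtain i where "i < n" "U \<inter> K \<subseteq> cyl (w @ [i])"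
      by blast
    then show ?case
      using w by (intro bexI[of _ "w @ [i]"]) (auto simp: level_def)
  qed simp
  moreover obtain m where "rmax ^ m < e"
    using rmax_power_small[OF assms] by blast
  ultimately obtain w where "w \<in> level {..<n} m" "U \<inter> K \<subseteq> cyl w" by blast
  then have "w \<in> Words" "weight r w < e" "U \<inter> K \<subseteq> cyl w"
    using weight_r_le[of w] \<open>rmax ^ m < e\<close> by (auto simp: level_def)
  then show False
    using no by blast
qed

lemma ex_comparable_cyl_pair:
  assumes "x \<in> K" "y \<in> K" "x \<noteq> y"
  shows "\<exists>w\<in>Words. x \<in> cyl w \<and> y \<in> cyl w \<and> gap * weight r w \<le> dist x y"
proof -
  (* A cylinder of ratio below e is too small to contain both points. *)
  define e where "e = dist x y / (diameter K + 1)"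
  have "0 < e"
    using assms diameter_K_nonneg by (simp add: e_def)
  then obtain w where w: "w \<in> Words" "{x, y} \<inter> K \<subseteq> cyl w" and
    alt: "(\<exists>a\<in>{x, y} \<inter> K. \<exists>b\<in>{x, y} \<inter> K. gap * weight r w \<le> dist a b) \<or> weight r w < e"
    using ex_comparable_cyl[of e "{x, y}"] by blast
  have "\<not> weight r w < e"
  proof
    assume "weight r w < e"
    then have "weight r w * (diameter K + 1) < dist x y"
      using diameter_K_nonneg by (simp add: e_def pos_less_divide_eq)
    moreover have "dist x y \<le> weight r w * diameter K"
      using w assms by (intro dist_cyl_le) auto
    ultimately show False
      using weight_r_pos[OF w(1)] by (simp add: algebra_simps)
  qed
  then obtain a b where ab: "a \<in> {x, y}" "b \<in> {x, y}" "gap * weight r w \<le> dist a b"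
    using alt by blast
  have "dist a b \<le> dist x y"
    using ab(1,2) by (auto simp: dist_commute)
  with ab(3) have "gap * weight r w \<le> dist x y"
    by linarith
  with w assms show ?thesis by blast
qed

text \<open>
  Up to a constant factor, the distance of two points of \<open>K\<close> is the ratio of the smallest cylinder
  containing both. Hence a map is Lipschitz as soon as its oscillation on cylinders is controlled.
\<close>

lemma lipschitz_onI_cyl:
  assumes "0 \<le> B"
    and "\<And>w x y. w \<in> Words \<Longrightarrow> x \<in> cyl w \<Longrightarrow> y \<in> cyl w \<Longrightarrow> dist (h x) (h y) \<le> B * weight r w"
  shows "(B / gap)-lipschitz_on K h"
proof (rule lipschitz_onI)
  fix x y assume "x \<in> K" "y \<in> K"
  show "dist (h x) (h y) \<le> B / gap * dist x y"
  proof (cases "x = y")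
    case False
    then obtain w where w: "w \<in> Words" "x \<in> cyl w" "y \<in> cyl w" "gap * weight r w \<le> dist x y"
      using ex_comparable_cyl_pair \<open>x \<in> K\<close> \<open>y \<in> K\<close> by blast
    have "dist (h x) (h y) \<le> B / gap * (gap * weight r w)"
      using assms(2)[OF w(1-3)] gap_pos by simp
    also have "\<dots> \<le> B / gap * dist x y"
      using w(4) assms(1) gap_pos by (intro mult_left_mono) auto
    finally show ?thesis .
  qed simp
qed (use assms(1) gap_pos in simp)

text \<open>
  A closed subset of an ultrametric space is a Lipschitz retract: send \<open>x\<close> to a point of \<open>C\<close> in the
  smallest cylinder around \<open>x\<close> that meets \<open>C\<close>, the point depending on that cylinder only.
\<close>

lemma ex_lipschitz_retraction:
  assumes C: "closed C" "C \<noteq> {}" "C \<subseteq> K"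
  shows "\<exists>h L. L-lipschitz_on K h \<and> h ` K = C \<and> (\<forall>x\<in>C. h x = x)"
proof -
  (* The smallest cylinder around x that meets C has the longest word with the property P x; its length
     is bounded since x has a positive distance from C. *)
  define P where "P x w \<longleftrightarrow> w \<in> Words \<and> x \<in> cyl w \<and> cyl w \<inter> C \<noteq> {}" for x w
  have P_Nil: "P x []" if "x \<in> K" for x
    using that C by (auto simp: P_def)
  have bdd: "\<exists>m. \<forall>w. P x w \<longrightarrow> length w \<le> m" if x: "x \<in> K" "x \<notin> C" for x
  proof -
    obtain e where e: "0 < e" "\<And>y. y \<in> C \<Longrightarrow> e \<le> dist x y"
      using separate_point_closed[OF C(1) x(2)] by blast
    obtain m where m: "rmax ^ m < e / (diameter K + 1)"
      using rmax_power_small[of "e / (diameter K + 1)"] e(1) diameter_K_nonneg by auto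
    have "length w \<le> m" if w: "P x w" for w
    proof (rule ccontr)
      assume "\<not> length w \<le> m"
      then have "rmax ^ length w \<le> rmax ^ m"
        using rmax by (intro power_decreasing) auto
      then have "weight r w < e / (diameter K + 1)"
        using weight_r_le[of w] w m by (simp add: P_def)
      then have "weight r w * (diameter K + 1) < e"
        using diameter_K_nonneg by (simp add: pos_less_divide_eq)
      moreover obtain y where "y \<in> cyl w" "y \<in> C"
        using w by (auto simp: P_def)
      then have "e \<le> weight r w * diameter K"
        using e(2)[of y] dist_cyl_le[of w x y] w by (auto simp: P_def)
      ultimately show False
        using weight_r_pos[of w] w by (auto simp: P_def algebra_simps)
    qed
    then show ?thesis by blast
  qed
  define top where "top x = (ARG_MAX length w. P x w)" for x
  have top: "P x (top x)" "\<And>w. P x w \<Longrightarrow> length w \<le> length (top x)" if x: "x \<in> K" "x \<notin> C" for x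
  proof -
    obtain m where "\<forall>w. P x w \<longrightarrow> length w \<le> m" using bdd[OF x] by blast
    then have *: "\<forall>w. P x w \<longrightarrow> length w < Suc m" by (simp add: less_Suc_eq_le)
    show "P x (top x)"
      unfolding top_def by (rule arg_max_natI[of "P x" _ _ "Suc m"]) (use P_Nil x * in auto)
    show "\<And>w. P x w \<Longrightarrow> length w \<le> length (top x)"
      unfolding top_def by (rule arg_max_nat_le[of "P x" _ _ "Suc m"]) (use * in auto)
  qed
  define c where "c w = (SOME y. y \<in> cyl w \<inter> C)" for w
  have c: "c w \<in> cyl w \<inter> C" if "cyl w \<inter> C \<noteq> {}" for w
    unfolding c_def by (rule someI_ex) (use that in blast)
  define h where "h x = (if x \<in> C then x else c (top x))" for x
  have hC: "h x \<in> C" if "x \<in> K" for x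
    using that c[of "top x"] top(1)[OF that] by (auto simp: h_def P_def)
  (* The oscillation of h on a cylinder: if it meets C, then h maps it into itself. *)
  have h_in: "h x \<in> cyl w" if w: "w \<in> Words" "x \<in> cyl w" "cyl w \<inter> C \<noteq> {}" for x w
  proof (cases "x \<in> C")
    case False
    have xK: "x \<in> K" using w cyl_subset_K by auto
    have "P x w" using w by (simp add: P_def)
    then have len: "length w \<le> length (top x)" using top(2)[OF xK False] by blast
    have t: "top x \<in> Words" "x \<in> cyl (top x)" "cyl (top x) \<inter> C \<noteq> {}"
      using top(1)[OF xK False] by (auto simp: P_def)
    have "prefix w (top x)"
      using cyl_meet_prefix[OF w(1) t(1) w(2) t(2)] prefix_length_prefix[of w w "top x"] len by blast
    then show ?thesis
      using cyl_prefix_subset[OF t(1)] c[OF t(3)] False by (auto simp: h_def)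
  qed (use w in \<open>simp add: h_def\<close>)
  (* If it misses C, then all its points have the same smallest cylinder that meets C. *)
  have h_const: "h x = h y" if w: "w \<in> Words" "x \<in> cyl w" "y \<in> cyl w" "cyl w \<inter> C = {}" for x y w
  proof -
    have "P x v \<longleftrightarrow> P y v" for v
    proof -
      have "P b v" if P: "P a v" and ab: "a \<in> cyl w" "b \<in> cyl w" for a b
      proof -
        have "prefix v w \<or> prefix w v"
          using P ab w(1) cyl_meet_prefix[of v w a] by (simp add: P_def)
        moreover have "\<not> prefix w v"
          using P w(4) cyl_prefix_subset[of v w] unfolding P_def by blast
        ultimately show ?thesis
          using P ab cyl_prefix_subset[OF w(1), of v] unfolding P_def by blast
      qed
      then show ?thesis using w(2,3) by blast
    qed
    then have "P x = P y" by blast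
    then show ?thesis using w by (auto simp: h_def top_def)
  qed
  have "(diameter K / gap)-lipschitz_on K h"
  proof (rule lipschitz_onI_cyl[OF diameter_K_nonneg])
    fix w x y assume w: "w \<in> Words" "x \<in> cyl w" "y \<in> cyl w"
    show "dist (h x) (h y) \<le> diameter K * weight r w"
    proof (cases "cyl w \<inter> C = {}")
      case True
      then show ?thesis
        using h_const[OF w] diameter_K_nonneg weight_r_pos[OF w(1)] by simp
    next
      case False
      then show ?thesis
        using dist_cyl_le[OF w(1) h_in[OF w(1,2)] h_in[OF w(1,3)]] by (simp add: mult.commute)
    qed
  qed
  moreover have "h ` K = C"
    using hC C(3) by (force simp: h_def)
  moreover have "\<forall>x\<in>C. h x = x"
    by (simp add: h_def)
  ultimately show ?thesis
    by blast
qed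

end

section \<open>Hausdorff measure and covers by cylinders\<close>

lemma diameter_power_eq_powr: "0 < s \<Longrightarrow> diameter_power s U = ennreal (diameter U powr s)"
  by (simp add: diameter_power_def)

lemma hausdorff_premeasure_le_finite_cover:
  fixes U :: "'i \<Rightarrow> 'a::metric_space set"
  assumes s: "0 < s" and \<delta>: "0 \<le> \<delta>" and I: "finite I" and A: "A \<subseteq> (\<Union>i\<in>I. U i)"
    and U: "\<And>i. i \<in> I \<Longrightarrow> bounded (U i)" "\<And>i. i \<in> I \<Longrightarrow> diameter (U i) \<le> \<delta>"
  shows "hausdorff_premeasure s \<delta> A \<le> ennreal (\<Sum>i\<in>I. diameter (U i) powr s)"
proof -
  obtain e where e: "bij_betw e {0..<card I} I"
    using ex_bij_betw_nat_finite[OF I] by blast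
  define V where "V k = (if k < card I then U (e k) else {})" for k
  have eI: "e k \<in> I" if "k < card I" for k
    using bij_betwE[OF e] that by auto
  have "A \<subseteq> (\<Union>k. V k)"
  proof
    fix x assume "x \<in> A"
    then obtain i where i: "i \<in> I" "x \<in> U i" using A by blast
    then obtain k where "k < card I" "i = e k"
      using e by (metis atLeastLessThan_iff bij_betw_imp_surj_on imageE)
    with i show "x \<in> (\<Union>k. V k)" by (auto simp: V_def)
  qed
  moreover have "bounded (V k) \<and> diameter (V k) \<le> \<delta>" for k
    using U eI \<delta> by (auto simp: V_def)
  ultimately have "hausdorff_premeasure s \<delta> A \<le> (\<Sum>k. diameter_power s (V k))"
    unfolding hausdorff_premeasure_def by (intro INF_lower) auto
  also have "\<dots> = (\<Sum>k\<in>{0..<card I}. diameter_power s (V k))"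
    by (rule suminf_finite) (auto simp: V_def diameter_power_def)
  also have "\<dots> = (\<Sum>k\<in>{0..<card I}. diameter_power s (U (e k)))"
    by (simp add: V_def)
  also have "\<dots> = (\<Sum>i\<in>I. diameter_power s (U i))"
    by (rule sum.reindex_bij_betw[OF e])
  also have "\<dots> = ennreal (\<Sum>i\<in>I. diameter (U i) powr s)"
    using s by (simp add: diameter_power_eq_powr)
  finally show ?thesis .
qed

context dust_like_ifs
begin

lemma sum_weight_powr:
  assumes "W \<subseteq> Words"
  shows "(\<Sum>w\<in>W. weight r w powr u) = (\<Sum>w\<in>W. weight (\<lambda>i. r i powr u) w)"
proof (rule sum.cong[OF refl])
  fix w assume "w \<in> W"
  then show "weight r w powr u = weight (\<lambda>i. r i powr u) w"
    by (intro weight_powr[of "{..<n}"]) (use assms ratio in auto)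
qed

lemma finite_cylinder_cover_weight_ge_1:
  assumes W: "finite W" "W \<subseteq> Words" "K \<subseteq> (\<Union>w\<in>W. cyl w)"
    and u: "1 \<le> (\<Sum>i<n. r i powr u)"
  shows "1 \<le> (\<Sum>w\<in>W. weight r w powr u)"
proof -
  define N where "N = Max (length ` W)"
  have N: "length w \<le> N" if "w \<in> W" for w
    using that W(1) by (auto simp: N_def)
  have "\<exists>w\<in>W. prefix w v" if v: "v \<in> level {..<n} N" for v
  proof -
    have vW: "v \<in> Words" "length v = N" using v by (auto simp: level_def)
    obtain x where x: "x \<in> cyl v" using cyl_nonempty by blast
    then obtain w where w: "w \<in> W" "x \<in> cyl w"
      using W(3) cyl_subset_K[OF vW(1)] by blast
    have "prefix w v \<or> prefix v w"
      using cyl_meet_prefix[of w v x] w x vW W(2) by blast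
    then have "prefix w v"
      using prefix_length_prefix[of w w v] N[OF w(1)] vW(2) by auto
    with w show ?thesis by blast
  qed
  then have "1 \<le> (\<Sum>w\<in>W. weight (\<lambda>i. r i powr u) w)"
    by (intro sum_weight_bar_ge_1[of "{..<n}" _ W N]) (use W N u ratio(1) in \<open>force+\<close>)
  then show ?thesis
    using sum_weight_powr[OF W(2)] by simp
qed

text \<open>Cylinders are open in \<open>K\<close> by strong separation.\<close>

lemma cylinder_cover_compact:
  assumes w: "\<And>i. i \<in> I \<Longrightarrow> w i \<in> Words" and cov: "K \<subseteq> (\<Union>i\<in>I. cyl (w i))"
  shows "\<exists>J. finite J \<and> J \<subseteq> I \<and> K \<subseteq> (\<Union>i\<in>J. cyl (w i))"
proof -
  define O' where "O' i = (\<Union>x\<in>cyl (w i). ball x (gap * weight r (w i)))" for i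
  have "cyl (w i) \<subseteq> O' i" if "i \<in> I" for i
    using gap_pos weight_r_pos[OF w[OF that]] by (auto simp: O'_def)
  then have sub: "K \<subseteq> (\<Union>i\<in>I. O' i)" using cov by blast
  have opn: "open (O' i)" for i by (auto simp: O'_def)
  obtain J where J: "J \<subseteq> I" "finite J" "K \<subseteq> (\<Union>i\<in>J. O' i)"
    by (rule compactE_image[OF K_compact opn sub])
  have "O' i \<inter> K \<subseteq> cyl (w i)" if "i \<in> I" for i
    using in_cyl_if_close[OF w[OF that]] unfolding O'_def by auto
  with J have "K \<subseteq> (\<Union>i\<in>J. cyl (w i))" by blast
  with J show ?thesis by blast
qed

text \<open>
  The mass distribution principle, in a combinatorial form: every cover is replaced by a cover by
  cylinders of comparable size, which weighs at least \<open>1\<close>. Sets of the cover that contain at most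
  one point of \<open>K\<close> get cylinders of a total weight of at most \<open>1 / 2\<close>.
\<close>

lemma hausdorff_measure_pos:
  assumes u: "0 \<le> u" "1 \<le> (\<Sum>i<n. r i powr u)"
  shows "0 < hausdorff_measure u K"
proof -
  define c where "c = (if u = 0 then 1 else gap powr u / 2)"
  have c: "0 < c" using gap_pos by (simp add: c_def)
  have "ennreal c \<le> (\<Sum>k. diameter_power u (U k))"
    if U: "K \<subseteq> (\<Union>k. U k)" "\<And>k. bounded (U k)" for U :: "nat \<Rightarrow> 'a set"
  proof (cases "u = 0")
    case True
    obtain k where "U k \<noteq> {}"
      using U(1) K_nonempty by blast
    then have "ennreal c = (\<Sum>k\<in>{k}. diameter_power u (U k))"
      using True by (simp add: c_def diameter_power_def)
    also have "\<dots> \<le> (\<Sum>k. diameter_power u (U k))"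
      by (rule sum_le_suminf) auto
    finally show ?thesis .
  next
    case False
    then have u0: "0 < u" using u by simp
    (* The masses spent on sets of the cover that have at most one point in K; they add up to 1/2. *)
    define e :: "nat \<Rightarrow> real" where "e k = (1/2) ^ (k + 2)" for k
    have e: "0 < e k" for k by (simp add: e_def)
    have "\<exists>w\<in>Words. U k \<inter> K \<subseteq> cyl w \<and> weight r w powr u \<le> diameter (U k) powr u / gap powr u + e k" for k
    proof -
      obtain w where w: "w \<in> Words" "U k \<inter> K \<subseteq> cyl w" and
        alt: "(\<exists>x\<in>U k \<inter> K. \<exists>y\<in>U k \<inter> K. gap * weight r w \<le> dist x y) \<or> weight r w < e k powr (1/u)"
        using ex_comparable_cyl[of "e k powr (1/u)" "U k"] e[of k] by auto
      note pos = weight_r_pos[OF w(1)]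
      from alt have "weight r w powr u \<le> diameter (U k) powr u / gap powr u + e k"
      proof
        assume "\<exists>x\<in>U k \<inter> K. \<exists>y\<in>U k \<inter> K. gap * weight r w \<le> dist x y"
        then have "gap * weight r w \<le> diameter (U k)"
          using diameter_bounded_bound[OF U(2)[of k]] order_trans by (metis IntD1)
        then have "(gap * weight r w) powr u \<le> diameter (U k) powr u"
          using gap_pos pos u0 by (intro powr_mono2) auto
        then have "weight r w powr u \<le> diameter (U k) powr u / gap powr u"
          using gap_pos pos by (simp add: powr_mult field_simps)
        then show ?thesis using e[of k] by linarith
      next
        assume "weight r w < e k powr (1/u)"
        then have "weight r w powr u \<le> (e k powr (1/u)) powr u"
          using pos u0 by (intro powr_mono2) auto
        also have "\<dots> = e k"
          using u0 e[of k] by (simp add: powr_powr)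
        finally show ?thesis
          by (simp add: add_increasing)
      qed
      with w show ?thesis by blast
    qed
    then obtain w where w: "\<And>k. w k \<in> Words" "\<And>k. U k \<inter> K \<subseteq> cyl (w k)"
        "\<And>k. weight r (w k) powr u \<le> diameter (U k) powr u / gap powr u + e k"
      by metis
    have "K \<subseteq> (\<Union>k\<in>UNIV. cyl (w k))" using U(1) w(2) by blast
    then obtain J where J: "finite J" "K \<subseteq> (\<Union>k\<in>J. cyl (w k))"
      using cylinder_cover_compact[of UNIV w, OF w(1)] by blast
    have "1 \<le> (\<Sum>v\<in>w ` J. weight r v powr u)"
      using J w(1) u(2) by (intro finite_cylinder_cover_weight_ge_1) auto
    also have "\<dots> \<le> (\<Sum>k\<in>J. weight r (w k) powr u)"
      using sum_image_le[OF J(1), of "\<lambda>v. weight r v powr u" w] by (simp add: o_def)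
    also have "\<dots> \<le> (\<Sum>k\<in>J. diameter (U k) powr u / gap powr u + e k)"
      by (intro sum_mono w(3))
    also have "\<dots> = (\<Sum>k\<in>J. diameter (U k) powr u) / gap powr u + (\<Sum>k\<in>J. e k)"
      by (simp add: sum.distrib sum_divide_distrib)
    also have "(\<Sum>k\<in>J. e k) \<le> 1/2"
    proof -
      have "(\<lambda>k. (1/2) ^ k * (1/4) :: real) sums (2 * (1/4))"
        using sums_mult2[OF geometric_sums[of "1/2::real"], of "1/4"] by simp
      then have s: "e sums (1/2)"
        by (simp add: e_def[abs_def] power_add power2_eq_square)
      have "sum e J \<le> suminf e"
        using sums_summable[OF s] J(1) e by (intro sum_le_suminf) (auto intro: less_imp_le)
      then show ?thesis using sums_unique[OF s] by simp
    qed
    finally have "c \<le> (\<Sum>k\<in>J. diameter (U k) powr u)"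
      using gap_pos False by (simp add: c_def field_simps)
    then have "ennreal c \<le> (\<Sum>k\<in>J. diameter_power u (U k))"
      using u0 by (simp add: diameter_power_eq_powr ennreal_leI)
    also have "\<dots> \<le> (\<Sum>k. diameter_power u (U k))"
      by (rule sum_le_suminf) (use J(1) in auto)
    finally show ?thesis .
  qed
  then have "ennreal c \<le> hausdorff_premeasure u 1 K"
    unfolding hausdorff_premeasure_def by (intro INF_greatest) auto
  also have "\<dots> \<le> hausdorff_measure u K"
    unfolding hausdorff_measure_def by (rule SUP_upper) simp
  finally show ?thesis
    using c by (auto intro: less_le_trans[of _ "ennreal c"])
qed

text \<open>
  If the sum exceeded \<open>1\<close>, it would still do so for some \<open>t > s\<close>, and the measures of all dimensions
  up to \<open>t\<close> would be positive.
\<close>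

lemma sum_ratio_powr_dim_le_1:
  assumes dim: "hausdorff_dim K \<le> ereal s"
  shows "(\<Sum>i<n. r i powr s) \<le> 1"
proof (rule ccontr)
  define g where "g u = (\<Sum>i<n. r i powr u)" for u
  assume "\<not> (\<Sum>i<n. r i powr s) \<le> 1"
  then have gs: "1 < g s" by (simp add: g_def)
  have "isCont g s"
    unfolding g_def using ratio(1) by (intro continuous_intros) (auto simp: less_imp_neq[symmetric])
  then have "(g \<longlongrightarrow> g s) (at_right s)"
    by (simp add: isCont_def filterlim_at_split)
  then have "eventually (\<lambda>u. 1 < g u) (at_right s)"
    using gs by (rule order_tendstoD)
  then obtain b where b: "s < b" "\<And>u. s < u \<Longrightarrow> u < b \<Longrightarrow> 1 < g u"
    unfolding eventually_at_right_field by blast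
  define t where "t = (s + b) / 2"
  have t: "s < t" "1 < g t" using b by (auto simp: t_def)
  have "t \<le> u" if "0 \<le> u" "hausdorff_measure u K = 0" for u
  proof (rule ccontr)
    assume "\<not> t \<le> u"
    then have "g t \<le> g u"
      unfolding g_def using ratio by (intro sum_mono powr_mono') (auto intro: less_imp_le)
    then have "1 \<le> (\<Sum>i<n. r i powr u)" using t by (simp add: g_def)
    then show False using hausdorff_measure_pos[OF that(1)] that(2) by simp
  qed
  then have "ereal t \<le> hausdorff_dim K"
    unfolding hausdorff_dim_def by (intro INF_greatest) auto
  from order_trans[OF this dim] t(1) show False
    by simp
qed

lemma dim_pos:
  assumes "(\<Sum>i<n. r i powr s) \<le> 1"
  shows "0 < s"
proof (rule ccontr)
  assume "\<not> 0 < s"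
  then have "1 \<le> r i powr s" if "i < n" for i
    using ratio[OF that] powr_mono'[of s 0 "r i"] by simp
  then have "(\<Sum>i<n. 1) \<le> (\<Sum>i<n. r i powr s)"
    by (intro sum_mono) simp
  then show False using assms two_maps by simp
qed

text \<open>
  Splitting cylinders into small ones does not increase the weight, so that covers by large cylinders
  bound the Hausdorff measure as well.
\<close>

lemma cylinder_content_pos:
  assumes s: "(\<Sum>i<n. r i powr s) \<le> 1" and A: "0 < hausdorff_measure s A"
  obtains \<theta> where "0 < \<theta>"
    "\<And>W. finite W \<Longrightarrow> W \<subseteq> Words \<Longrightarrow> A \<subseteq> (\<Union>w\<in>W. cyl w) \<Longrightarrow> \<theta> \<le> (\<Sum>w\<in>W. weight r w powr s)"
proof -
  define D where "D = diameter K"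
  have D: "0 \<le> D" using diameter_K_nonneg by (simp add: D_def)
  have s0: "0 < s" using dim_pos[OF s] .
  obtain \<delta> where \<delta>: "0 < \<delta>" "0 < hausdorff_premeasure s \<delta> A"
    using A unfolding hausdorff_measure_def less_SUP_iff by auto
  obtain h where h: "0 < h" "ennreal h \<le> hausdorff_premeasure s \<delta> A"
  proof (cases "hausdorff_premeasure s \<delta> A")
    case (real x)
    then show ?thesis using that[of x] \<delta> by (auto simp: ennreal_less_zero_iff)
  next
    case top
    then show ?thesis using that[of 1] by simp
  qed
  (* Descendants of generation q of any cylinder have a diameter of at most \<delta>. *)
  have "\<exists>q. rmax ^ q < \<delta> / (D + 1)"
    using \<delta> D by (intro rmax_power_small) auto
  then obtain q where q: "rmax ^ q < \<delta> / (D + 1)" by blast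
  have main: "h \<le> D powr s * (\<Sum>w\<in>W. weight r w powr s)"
    if W: "finite W" "W \<subseteq> Words" "A \<subseteq> (\<Union>w\<in>W. cyl w)" for W
  proof -
    define I where "I = W \<times> level {..<n} q"
    define U where "U = (\<lambda>(w, v). cyl (w @ v))"
    have finI: "finite I" using W(1) finite_level[of "{..<n}"] by (simp add: I_def)
    have IW: "w \<in> Words" "v \<in> Words" "length v = q" if "(w, v) \<in> I" for w v
      using that W(2) by (auto simp: I_def level_def)
    have small: "diameter (U i) \<le> \<delta>" if "i \<in> I" for i
    proof -
      obtain w v where i: "i = (w, v)" by (cases i)
      note wv = IW[OF that[unfolded i]]
      have "diameter (U i) \<le> weight r (w @ v) * D"
        using diameter_cyl_le[of "w @ v"] wv by (simp add: U_def i D_def)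
      also have "\<dots> \<le> rmax ^ q * (D + 1)"
        using weight_r_le[OF wv(2)] weight_r_le_1[OF wv(1)] weight_r_pos[OF wv(1)] weight_r_pos[OF wv(2)] wv(3) D rmax(1)
          mult_mono[of "weight r w" 1 "weight r v" "rmax ^ q"]
        by (intro mult_mono) auto
      also have "\<dots> \<le> \<delta>"
        using q D by (simp add: pos_less_divide_eq less_imp_le)
      finally show ?thesis .
    qed
    have "A \<subseteq> (\<Union>i\<in>I. U i)"
    proof
      fix x assume "x \<in> A"
      then obtain w where w: "w \<in> W" "x \<in> cyl w" using W(3) by blast
      then obtain v where "v \<in> level {..<n} q" "x \<in> cyl (w @ v)"
        using cyl_extension by blast
      with w show "x \<in> (\<Union>i\<in>I. U i)"
        by (auto simp: I_def U_def)
    qed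
    then have "hausdorff_premeasure s \<delta> A \<le> ennreal (\<Sum>i\<in>I. diameter (U i) powr s)"
      using \<delta>(1) s0 finI small IW bounded_cyl
      by (intro hausdorff_premeasure_le_finite_cover) (auto simp: U_def)
    with h(2) have "ennreal h \<le> ennreal (\<Sum>i\<in>I. diameter (U i) powr s)"
      by (rule order_trans)
    then have "h \<le> (\<Sum>i\<in>I. diameter (U i) powr s)"
      by (simp add: sum_nonneg)
    also have "\<dots> \<le> (\<Sum>(w, v)\<in>I. D powr s * (weight r w powr s * weight r v powr s))"
    proof (rule sum_mono)
      fix i assume "i \<in> I"
      then obtain w v where i: "i = (w, v)" and wv: "w \<in> Words" "v \<in> Words"
        using IW by (cases i) blast
      have "0 \<le> diameter (U i)"
        using diameter_ge_0[OF bounded_cyl[of "w @ v"]] wv by (simp add: U_def i)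
      then have "diameter (U i) powr s \<le> (weight r (w @ v) * D) powr s"
        using diameter_cyl_le[of "w @ v"] wv s0 by (intro powr_mono2) (auto simp: U_def i D_def)
      also have "\<dots> = D powr s * (weight r w powr s * weight r v powr s)"
        using weight_r_pos wv D by (simp add: powr_mult less_imp_le mult_ac)
      finally show "diameter (U i) powr s \<le> (case i of (w, v) \<Rightarrow> D powr s * (weight r w powr s * weight r v powr s))"
        by (simp add: i)
    qed
    also have "\<dots> = D powr s * ((\<Sum>w\<in>W. weight r w powr s) * (\<Sum>v\<in>level {..<n} q. weight r v powr s))"
      unfolding I_def sum_product sum.cartesian_product[symmetric] by (simp only: sum_distrib_left)
    also have "(\<Sum>v\<in>level {..<n} q. weight r v powr s) = (\<Sum>i<n. r i powr s) ^ q"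
      using sum_weight_powr[of "level {..<n} q" s] sum_weight_level[of "\<lambda>i. r i powr s" "{..<n}" q]
      by (simp add: level_def subset_iff)
    also have "D powr s * ((\<Sum>w\<in>W. weight r w powr s) * (\<Sum>i<n. r i powr s) ^ q)
        \<le> D powr s * ((\<Sum>w\<in>W. weight r w powr s) * 1)"
      using s by (intro mult_left_mono power_le_one) (auto intro: sum_nonneg)
    finally show ?thesis by simp
  qed
  show ?thesis
  proof (rule that[of "h / (D powr s + 1)"])
    have pos: "0 < D powr s + 1" by (simp add: add_nonneg_pos)
    then show "0 < h / (D powr s + 1)" using h by simp
    fix W assume W: "finite W" "W \<subseteq> Words" "A \<subseteq> (\<Union>w\<in>W. cyl w)"
    have "0 \<le> (\<Sum>w\<in>W. weight r w powr s)" by (simp add: sum_nonneg)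
    then have "h \<le> (D powr s + 1) * (\<Sum>w\<in>W. weight r w powr s)"
      using main[OF W] by (simp add: algebra_simps)
    then show "h / (D powr s + 1) \<le> (\<Sum>w\<in>W. weight r w powr s)"
      using pos by (simp add: pos_divide_le_eq mult.commute)
  qed
qed

end

context dust_like_ifs
begin

section \<open>Cylinders of a given size\<close>

text \<open>The cylinders of these words are a partition of \<open>K\<close> into pieces of size about \<open>\<rho>\<close>.\<close>

definition cut :: "real \<Rightarrow> nat list set" where
  "cut \<rho> = {w \<in> Words. weight r w \<le> \<rho> \<and> (\<forall>v. strict_prefix v w \<longrightarrow> \<rho> < weight r v)}"

lemma cut_antichain: "v \<in> cut \<rho> \<Longrightarrow> w \<in> cut \<rho> \<Longrightarrow> prefix v w \<Longrightarrow> v = w"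
  unfolding cut_def strict_prefix_def by fastforce

lemma cut_weight_ge:
  assumes w: "w \<in> cut \<rho>" and \<rho>: "\<rho> < 1"
  shows "rmin * \<rho> \<le> weight r w"
proof (cases w rule: rev_cases)
  case Nil
  then show ?thesis using assms by (simp add: cut_def)
next
  case (snoc v i)
  then have *: "i < n" "v \<in> Words" "\<rho> < weight r v"
    using w by (auto simp: cut_def strict_prefix_def)
  have "rmin * \<rho> \<le> rmin * weight r v"
    using * rmin(1) by simp
  also have "\<dots> \<le> r i * weight r v"
    using * rmin(2) weight_r_pos by (intro mult_right_mono) (auto intro: less_imp_le)
  finally show ?thesis
    using snoc by (simp add: mult.commute)
qed

lemma finite_cut:
  assumes "0 < \<rho>"
  shows "finite (cut \<rho>)"
proof -
  obtain q where q: "rmax ^ q < \<rho>" using rmax_power_small[OF assms] by blast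
  have "length w \<le> q" if w: "w \<in> cut \<rho>" for w
  proof (rule ccontr)
    assume "\<not> length w \<le> q"
    then have len: "length (take q w) = q" and "take q w \<noteq> w"
      by auto
    then have "strict_prefix (take q w) w"
      by (simp add: strict_prefix_def take_is_prefix)
    then have "\<rho> < weight r (take q w)"
      using w by (simp add: cut_def)
    moreover have "take q w @ drop q w \<in> Words"
      using w by (simp add: cut_def)
    then have "weight r (take q w) \<le> rmax ^ q"
      using weight_r_le[of "take q w"] len by (simp only: append_in_lists_conv)
    ultimately show False using q by simp
  qed
  then have "cut \<rho> \<subseteq> {w. set w \<subseteq> {..<n} \<and> length w \<le> q}"
    by (auto simp: cut_def lists_eq_set)
  then show ?thesis
    by (rule finite_subset) (rule finite_lists_length_le, simp)
qed

lemma ex_cut_cyl: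
  assumes \<rho>: "0 < \<rho>" and x: "x \<in> K"
  shows "\<exists>w\<in>cut \<rho>. x \<in> cyl w"
proof -
  obtain q where q: "rmax ^ q < \<rho>" using rmax_power_small[OF \<rho>] by blast
  obtain w where w: "w \<in> level {..<n} q" "x \<in> cyl w"
    using cyl_extension[of x "[]" q] x by auto
  then have wW: "w \<in> Words" and wq: "weight r w \<le> \<rho>"
    using weight_r_le[of w] q by (auto simp: level_def)
  define k where "k = (LEAST k. weight r (take k w) \<le> \<rho>)"
  have k: "weight r (take k w) \<le> \<rho>"
    unfolding k_def by (rule LeastI[of _ "length w"]) (simp add: wq)
  have "take k w @ drop k w \<in> Words" using wW by simp
  then have tW: "take k w \<in> Words" by (simp only: append_in_lists_conv)
  have "\<rho> < weight r v" if v: "strict_prefix v (take k w)" for v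
  proof -
    have "v = take (length v) (take k w)"
      using v unfolding strict_prefix_def prefix_def by (auto simp del: take_take)
    moreover have len: "length v < length (take k w)"
      using v by (rule prefix_length_less)
    ultimately have "v = take (length v) w" by (metis length_take min.absorb1 min.strict_boundedE less_imp_le take_take)
    moreover have "\<not> weight r (take (length v) w) \<le> \<rho>"
      using len by (intro not_less_Least[of "length v" "\<lambda>k. weight r (take k w) \<le> \<rho>", folded k_def]) simp
    ultimately show ?thesis by simp
  qed
  with k tW have "take k w \<in> cut \<rho>" by (simp add: cut_def)
  moreover have "x \<in> cyl (take k w)"
    using cyl_prefix_subset[OF wW take_is_prefix] w(2) by blast
  ultimately show ?thesis by blast
qed

lemma antichain_weight_le_1:
  assumes "(\<Sum>i<n. r i powr s) \<le> 1" "finite W" "W \<subseteq> Words"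
    and "\<And>v w. v \<in> W \<Longrightarrow> w \<in> W \<Longrightarrow> prefix v w \<Longrightarrow> v = w"
  shows "(\<Sum>w\<in>W. weight r w powr s) \<le> 1"
proof -
  have "{..<n} \<noteq> {}" using two_maps by (auto simp: lessThan_empty_iff)
  then have "(\<Sum>w\<in>W. weight (\<lambda>i. r i powr s) w) \<le> 1"
    using assms ratio(1) by (intro sum_weight_antichain_le_1[of "{..<n}"]) force+
  then show ?thesis
    using sum_weight_powr[OF assms(3)] by simp
qed

section \<open>A cylinder on which a given set is nearly dense\<close>

text \<open>
  This replaces Lebesgue's density theorem. A set \<open>A\<close> of positive content has a nearly optimal cover
  by cylinders, and those in \<open>H\<close> make up at most half of it. If \<open>A\<close> missed,
  in every cylinder of the cover that is not in \<open>H\<close>, some descendant of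
  generation \<open>k\<close>, then replacing the cylinders by their descendants that meet \<open>A\<close> would reduce the
  weight of the cover by a fixed proportion, below the optimum.
\<close>

lemma ex_cyl_with_dense_trace:
  assumes s: "(\<Sum>i<n. r i powr s) \<le> 1" and A: "A \<subseteq> K" and \<theta>: "0 < \<theta>"
    and content: "\<And>W. finite W \<Longrightarrow> W \<subseteq> Words \<Longrightarrow> A \<subseteq> (\<Union>w\<in>W. cyl w) \<Longrightarrow>
        \<theta> \<le> (\<Sum>w\<in>W. weight r w powr s)"
    and H: "\<And>W. finite W \<Longrightarrow> W \<subseteq> Words \<inter> H \<Longrightarrow>
        (\<And>v w. v \<in> W \<Longrightarrow> w \<in> W \<Longrightarrow> prefix v w \<Longrightarrow> v = w) \<Longrightarrow> (\<Sum>w\<in>W. weight r w powr s) \<le> \<theta> / 2"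
  shows "\<exists>w\<in>Words - H. \<forall>v\<in>level {..<n} k. A \<inter> cyl (w @ v) \<noteq> {}"
proof (rule ccontr)
  assume no: "\<not> ?thesis"
  define wt where "wt w = weight r w powr s" for w
  have wt_nn: "0 \<le> wt w" for w by (simp add: wt_def)
  have s0: "0 < s" using dim_pos[OF s] .
  define covers where "covers = {W. finite W \<and> W \<subseteq> Words \<and> A \<subseteq> (\<Union>w\<in>W. cyl w)}"
  define T where "T = Inf (sum wt ` covers)"
  have bdd: "bdd_below (sum wt ` covers)"
    by (rule bdd_belowI[of _ 0]) (auto simp: sum_nonneg wt_nn)
  have T_le: "T \<le> sum wt W" if "W \<in> covers" for W
    unfolding T_def using that bdd by (intro cInf_lower) auto
  have "{[]} \<in> covers" using A by (simp add: covers_def)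
  then have ne: "sum wt ` covers \<noteq> {}" by blast
  have \<theta>T: "\<theta> \<le> T"
    unfolding T_def using ne content by (intro cInf_greatest) (auto simp: covers_def wt_def)
  (* Dropping one descendant of generation k of a cylinder saves at least this proportion of its mass. *)
  define \<eta> where "\<eta> = (rmin ^ k) powr s"
  have \<eta>: "0 < \<eta>" using rmin by (simp add: \<eta>_def)
  have "Inf (sum wt ` covers) < T + \<eta> * \<theta> / 2"
    using \<eta> \<theta> by (simp add: T_def)
  then obtain W0 where W0: "W0 \<in> covers" "sum wt W0 < T + \<eta> * \<theta> / 2"
    using cInf_lessD[OF ne] by blast
  (* Only the largest cylinders of the cover are kept: the hypothesis on H needs disjoint cylinders. *)
  define W where "W = {w \<in> W0. \<forall>v\<in>W0. prefix v w \<longrightarrow> v = w}"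
  have W: "finite W" "W \<subseteq> Words" using W0 by (auto simp: W_def covers_def)
  have anti: "v = w" if "v \<in> W" "w \<in> W" "prefix v w" for v w
    using that by (auto simp: W_def)
  have "\<exists>v\<in>W. prefix v w" if "w \<in> W0" for w
    using that
  proof (induction "length w" arbitrary: w rule: less_induct)
    case less
    show ?case
    proof (cases "w \<in> W")
      case False
      then obtain v where v: "v \<in> W0" "prefix v w" "v \<noteq> w"
        using less.prems by (auto simp: W_def)
      then have "length v < length w"
        by (intro prefix_length_less) (simp add: strict_prefix_def)
      then obtain u where "u \<in> W" "prefix u v"
        using less.hyps v(1) by blast
      with v(2) show ?thesis
        using prefix_order.order_trans by blast
    qed blast
  qed
  then have "(\<Union>w\<in>W0. cyl w) \<subseteq> (\<Union>w\<in>W. cyl w)"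
    using W0(1) cyl_prefix_subset unfolding covers_def by (smt (verit) UN_iff mem_Collect_eq subset_iff)
  then have AW: "A \<subseteq> (\<Union>w\<in>W. cyl w)"
    using W0(1) unfolding covers_def by blast
  have "sum wt W \<le> sum wt W0"
    using W0(1) wt_nn by (intro sum_mono2) (auto simp: W_def covers_def)
  then have sumW: "sum wt W < T + \<eta> * \<theta> / 2" using W0(2) by simp
  have "W \<in> covers" using W AW by (simp add: covers_def)
  then have TW: "T \<le> sum wt W" by (rule T_le)
  define B where "B = W - H"
  have B: "finite B" "B \<subseteq> Words" using W by (auto simp: B_def)
  have split: "sum wt W = sum wt (W \<inter> H) + sum wt B"
    unfolding B_def by (rule sum.Int_Diff[OF W(1)])
  have heavy: "sum wt (W \<inter> H) \<le> \<theta> / 2"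
    unfolding wt_def using W anti by (intro H) auto
  have "\<forall>w\<in>B. \<exists>v\<in>level {..<n} k. A \<inter> cyl (w @ v) = {}"
    using no W(2) by (auto simp: B_def)
  then obtain miss where miss: "\<And>w. w \<in> B \<Longrightarrow> miss w \<in> level {..<n} k"
      "\<And>w. w \<in> B \<Longrightarrow> A \<inter> cyl (w @ miss w) = {}"
    by metis
  define E where "E = (SIGMA w:B. level {..<n} k - {miss w})"
  define W' where "W' = (W \<inter> H) \<union> (\<lambda>(w, v). w @ v) ` E"
  have fin: "finite (level {..<n} k)" by (rule finite_level) simp
  have finE: "finite E" using B fin by (simp add: E_def)
  have EW: "w \<in> Words" "v \<in> Words" if "(w, v) \<in> E" for w v
    using that B by (auto simp: E_def level_def)
  have "A \<subseteq> (\<Union>w\<in>W'. cyl w)"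
  proof
    fix x assume x: "x \<in> A"
    then obtain w where w: "w \<in> W" "x \<in> cyl w" using AW by blast
    show "x \<in> (\<Union>w\<in>W'. cyl w)"
    proof (cases "w \<in> H")
      case True
      with w show ?thesis by (auto simp: W'_def)
    next
      case False
      then have wB: "w \<in> B" using w by (simp add: B_def)
      obtain v where v: "v \<in> level {..<n} k" "x \<in> cyl (w @ v)"
        using cyl_extension[OF w(2)] by blast
      then have "(w, v) \<in> E"
        using wB miss(2)[OF wB] x by (auto simp: E_def)
      then have "w @ v \<in> W'" by (force simp: W'_def)
      with v show ?thesis by blast
    qed
  qed
  then have "W' \<in> covers"
    using W finE EW by (auto simp: covers_def W'_def)
  then have "T \<le> sum wt W'" by (rule T_le)
  also have "\<dots> \<le> sum wt (W \<inter> H) + sum wt ((\<lambda>(w, v). w @ v) ` E)"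
  proof -
    have "0 \<le> sum wt ((W \<inter> H) \<inter> (\<lambda>(w, v). w @ v) ` E)" by (simp add: sum_nonneg wt_nn)
    then show ?thesis
      using sum.union_inter[of "W \<inter> H" "(\<lambda>(w, v). w @ v) ` E" wt] W(1) finE by (simp add: W'_def)
  qed
  also have "sum wt ((\<lambda>(w, v). w @ v) ` E) \<le> (\<Sum>(w, v)\<in>E. wt (w @ v))"
    using sum_image_le[OF finE, of wt "\<lambda>(w, v). w @ v"] wt_nn by (simp add: o_def case_prod_unfold)
  also have "\<dots> = (\<Sum>(w, v)\<in>E. wt w * wt v)"
    using EW weight_r_pos by (intro sum.cong) (auto simp: wt_def powr_mult less_imp_le)
  also have "\<dots> = (\<Sum>w\<in>B. wt w * (\<Sum>v\<in>level {..<n} k - {miss w}. wt v))"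
    unfolding E_def using B fin by (subst sum.Sigma[symmetric]) (auto simp: sum_distrib_left)
  also have "\<dots> \<le> (\<Sum>w\<in>B. wt w * (1 - \<eta>))"
  proof (intro sum_mono mult_left_mono wt_nn)
    fix w assume w: "w \<in> B"
    have "(\<Sum>v\<in>level {..<n} k. wt v) = (\<Sum>i<n. r i powr s) ^ k"
      using sum_weight_powr[of "level {..<n} k" s] sum_weight_level[of "\<lambda>i. r i powr s" "{..<n}" k]
      by (simp add: level_def subset_iff wt_def)
    also have "\<dots> \<le> 1" using s by (intro power_le_one) (auto intro: sum_nonneg)
    finally have le1: "(\<Sum>v\<in>level {..<n} k. wt v) \<le> 1" .
    have "\<eta> \<le> wt (miss w)"
      unfolding \<eta>_def wt_def using miss(1)[OF w] weight_r_ge[of "miss w"] rmin(1) s0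
      by (intro powr_mono2) (auto simp: level_def)
    then show "(\<Sum>v\<in>level {..<n} k - {miss w}. wt v) \<le> 1 - \<eta>"
      using le1 sum.remove[OF fin miss(1)[OF w], of wt] by simp
  qed
  also have "\<dots> = sum wt B - \<eta> * sum wt B"
    by (simp add: sum_distrib_left sum_subtractf algebra_simps)
  finally have "T \<le> sum wt W - \<eta> * sum wt B" using split by simp
  moreover have "\<theta> / 2 \<le> sum wt B" using split heavy TW \<theta>T by simp
  then have "\<eta> * (\<theta> / 2) \<le> \<eta> * sum wt B" using \<eta> by simp
  ultimately show False using sumW by simp
qed

end

section \<open>Rescaling a Lipschitz map between dust-like sets\<close>

locale lipschitz_between_dusts =
  K: dust_like_ifs n \<phi> r K + F: dust_like_ifs m \<psi> t F
  for n :: nat and \<phi> :: "nat \<Rightarrow> 'a::heine_borel \<Rightarrow> 'a" and r K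
    and m :: nat and \<psi> :: "nat \<Rightarrow> 'b::heine_borel \<Rightarrow> 'b" and t F +
  fixes f :: "'a \<Rightarrow> 'b" and L s :: real
  assumes lipschitz: "L-lipschitz_on K f" and image: "f ` K \<subseteq> F"
    and sum_K: "(\<Sum>i<n. r i powr s) \<le> 1" and sum_F: "(\<Sum>i<m. t i powr s) \<le> 1"
    and positive: "0 < hausdorff_measure s (f ` K)"
begin

text \<open>Cylinders of \<open>K\<close> of ratio at most \<open>scale\<close> times that of a cylinder of \<open>F\<close> have images too small to leave it
  if they meet it.\<close>

definition scale :: real where
  "scale = min (1/2) (F.gap / ((L + 1) * (diameter K + 1)))"

definition pieces :: "nat list \<Rightarrow> nat list set" where
  "pieces J = {I \<in> K.cut (scale * weight t J). f ` K.cyl I \<inter> F.cyl J \<noteq> {}}"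

lemma L_nonneg: "0 \<le> L"
  using lipschitz by (rule lipschitz_on_nonneg)

lemma scale: "0 < scale" "scale < 1" "L * diameter K * scale < F.gap"
proof -
  have p: "0 < (L + 1) * (diameter K + 1)"
    using L_nonneg K.diameter_K_nonneg by simp
  then show pos: "0 < scale" using F.gap_pos by (simp add: scale_def)
  show "scale < 1" by (simp add: scale_def)
  have "L * diameter K * scale < (L + 1) * (diameter K + 1) * scale"
  proof (rule mult_strict_right_mono[OF _ pos])
    have "L * diameter K \<le> (L + 1) * diameter K"
      using K.diameter_K_nonneg by (intro mult_right_mono) auto
    also have "\<dots> < (L + 1) * (diameter K + 1)"
      using L_nonneg by (intro mult_strict_left_mono) auto
    finally show "L * diameter K < (L + 1) * (diameter K + 1)" .
  qed
  also have "\<dots> \<le> F.gap"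
    using p min.cobounded2[of "1/2" "F.gap / ((L + 1) * (diameter K + 1))", folded scale_def]
    by (simp add: pos_le_divide_eq mult.commute)
  finally show "L * diameter K * scale < F.gap" .
qed

lemma pieces_Words: "I \<in> pieces J \<Longrightarrow> I \<in> K.Words"
  by (simp add: pieces_def K.cut_def)

lemma pieces_weight: "I \<in> pieces J \<Longrightarrow> weight r I \<le> scale * weight t J"
  by (simp add: pieces_def K.cut_def)

lemma finite_pieces: "J \<in> F.Words \<Longrightarrow> finite (pieces J)"
  using K.finite_cut[of "scale * weight t J"] F.weight_r_pos scale(1) by (simp add: pieces_def)

lemma pieces_image:
  assumes J: "J \<in> F.Words" and I: "I \<in> pieces J"
  shows "f ` K.cyl I \<subseteq> F.cyl J"
proof
  fix z assume "z \<in> f ` K.cyl I"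
  then obtain y where y: "y \<in> K.cyl I" "z = f y" by blast
  obtain x where x: "x \<in> K.cyl I" "f x \<in> F.cyl J" using I by (auto simp: pieces_def)
  have xy: "x \<in> K" "y \<in> K" using x y K.cyl_subset_K[OF pieces_Words[OF I]] by auto
  have "dist (f x) (f y) \<le> L * dist x y"
    using lipschitz xy by (intro lipschitz_onD)
  also have "\<dots> \<le> L * (weight r I * diameter K)"
    using K.dist_cyl_le[OF pieces_Words[OF I] x(1) y(1)] L_nonneg by (intro mult_left_mono)
  also have "\<dots> \<le> L * (scale * weight t J * diameter K)"
    using pieces_weight[OF I] L_nonneg K.diameter_K_nonneg by (intro mult_left_mono mult_right_mono)
  also have "\<dots> = L * diameter K * scale * weight t J" by simp
  also have "\<dots> < F.gap * weight t J"
    using scale(3) F.weight_r_pos[OF J] by simp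
  finally show "z \<in> F.cyl J"
    using F.in_cyl_if_close[OF J x(2), of "f y"] image xy y by auto
qed

text \<open>
  Because the image of a piece stays in its cylinder of \<open>F\<close>, the pieces of disjoint cylinders of \<open>F\<close> are
  disjoint, and all together have a mass of at most \<open>1\<close>. As the ratios of a cylinder and of its pieces are
  comparable, this bounds the total mass of the cylinders with many pieces.
\<close>

lemma weight_of_crowded_le:
  assumes W: "finite W" "W \<subseteq> F.Words" "\<And>J. J \<in> W \<Longrightarrow> M \<le> card (pieces J)"
    and anti: "\<And>v w. v \<in> W \<Longrightarrow> w \<in> W \<Longrightarrow> prefix v w \<Longrightarrow> v = w"
  shows "real M * (K.rmin * scale) powr s * (\<Sum>J\<in>W. weight t J powr s) \<le> 1"
proof -
  have s0: "0 < s" using K.dim_pos[OF sum_K] .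
  have same: "J = J'" if "J \<in> W" "J' \<in> W" "I \<in> pieces J" "I' \<in> pieces J'" "prefix I I'" for J J' I I'
  proof -
    obtain x where x: "x \<in> K.cyl I'" using K.cyl_nonempty by blast
    then have "x \<in> K.cyl I"
      using K.cyl_prefix_subset[OF pieces_Words[OF that(4)] that(5)] by blast
    then have "f x \<in> F.cyl J" "f x \<in> F.cyl J'"
      using pieces_image[of J I] pieces_image[of J' I'] that W(2) x by auto
    then have "prefix J J' \<or> prefix J' J"
      using F.cyl_meet_prefix[of J J' "f x"] that W(2) by blast
    then show ?thesis using anti that by blast
  qed
  have "(\<Sum>I\<in>(\<Union>J\<in>W. pieces J). weight r I powr s) \<le> 1"
  proof (rule K.antichain_weight_le_1[OF sum_K])
    show "finite (\<Union>J\<in>W. pieces J)" using W finite_pieces by blast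
    show "(\<Union>J\<in>W. pieces J) \<subseteq> K.Words" using pieces_Words by blast
    fix I I' assume I: "I \<in> (\<Union>J\<in>W. pieces J)" "I' \<in> (\<Union>J\<in>W. pieces J)" "prefix I I'"
    then obtain J where "I \<in> pieces J" "I' \<in> pieces J" using same by blast
    then show "I = I'" using K.cut_antichain[OF _ _ I(3)] unfolding pieces_def by blast
  qed
  also have "(\<Sum>I\<in>(\<Union>J\<in>W. pieces J). weight r I powr s) = (\<Sum>J\<in>W. \<Sum>I\<in>pieces J. weight r I powr s)"
    using W finite_pieces same by (intro sum.UNION_disjoint) blast+
  finally have le1: "(\<Sum>J\<in>W. \<Sum>I\<in>pieces J. weight r I powr s) \<le> 1" .
  have "real M * (K.rmin * scale) powr s * (\<Sum>J\<in>W. weight t J powr s)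
      = (\<Sum>J\<in>W. real M * ((K.rmin * scale) powr s * weight t J powr s))"
    by (simp add: sum_distrib_left mult.assoc)
  also have "\<dots> \<le> (\<Sum>J\<in>W. \<Sum>I\<in>pieces J. weight r I powr s)"
  proof (rule sum_mono)
    fix J assume J: "J \<in> W"
    then have pos: "0 < weight t J" and le1: "weight t J \<le> 1"
      using W(2) F.weight_r_pos F.weight_r_le_1 by auto
    have "scale * weight t J < 1"
      using mult_left_le[OF le1 less_imp_le[OF scale(1)]] scale(2) by linarith
    then have ge: "K.rmin * (scale * weight t J) \<le> weight r I" if "I \<in> pieces J" for I
      using K.cut_weight_ge that by (simp add: pieces_def)
    have "real M * ((K.rmin * scale) powr s * weight t J powr s) = real M * (K.rmin * (scale * weight t J)) powr s"
      using K.rmin(1) scale(1) pos by (simp add: powr_mult mult.assoc)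
    also have "\<dots> \<le> real (card (pieces J)) * (K.rmin * (scale * weight t J)) powr s"
      using W(3)[OF J] by (intro mult_right_mono) auto
    also have "\<dots> \<le> (\<Sum>I\<in>pieces J. weight r I powr s)"
      using ge s0 K.rmin(1) scale(1) pos by (intro sum_bounded_below powr_mono2) auto
    finally show "real M * ((K.rmin * scale) powr s * weight t J powr s) \<le> (\<Sum>I\<in>pieces J. weight r I powr s)" .
  qed
  finally show ?thesis using le1 by simp
qed

text \<open>
  For large \<open>M\<close> the cylinders of \<open>F\<close> with more than \<open>M\<close> pieces form a set \<open>H\<close> as in
  \<open>F.ex_cyl_with_dense_trace\<close>.
\<close>

lemma ex_uncrowded_cyl_with_dense_trace:
  "\<exists>M. \<forall>k. \<exists>J\<in>F.Words. card (pieces J) \<le> M \<and> (\<forall>v\<in>level {..<m} k. f ` K \<inter> F.cyl (J @ v) \<noteq> {})"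
proof -
  obtain \<theta> where \<theta>: "0 < \<theta>"
    "\<And>W. finite W \<Longrightarrow> W \<subseteq> F.Words \<Longrightarrow> f ` K \<subseteq> (\<Union>w\<in>W. F.cyl w) \<Longrightarrow> \<theta> \<le> (\<Sum>w\<in>W. weight t w powr s)"
    using F.cylinder_content_pos[OF sum_F positive] by blast
  define \<kappa> where "\<kappa> = (K.rmin * scale) powr s"
  have \<kappa>: "0 < \<kappa>" using K.rmin(1) scale(1) by (simp add: \<kappa>_def)
  obtain M :: nat where M: "2 / (\<theta> * \<kappa>) < real M"
    using reals_Archimedean2 by blast
  have "\<exists>J\<in>F.Words - {J. M < card (pieces J)}. \<forall>v\<in>level {..<m} k. f ` K \<inter> F.cyl (J @ v) \<noteq> {}" for k
  proof (rule F.ex_cyl_with_dense_trace[OF sum_F image \<theta>])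
    fix W assume W: "finite W" "W \<subseteq> F.Words \<inter> {J. M < card (pieces J)}"
      and anti: "\<And>v w. v \<in> W \<Longrightarrow> w \<in> W \<Longrightarrow> prefix v w \<Longrightarrow> v = w"
    define S where "S = (\<Sum>J\<in>W. weight t J powr s)"
    have "real M * \<kappa> * S \<le> 1"
      unfolding \<kappa>_def S_def using W anti by (intro weight_of_crowded_le) auto
    moreover have "2 / \<theta> * S \<le> real M * \<kappa> * S"
    proof (rule mult_right_mono)
      show "2 / \<theta> \<le> real M * \<kappa>"
        using M \<theta>(1) \<kappa> by (simp add: field_simps)
      show "0 \<le> S" by (simp add: S_def sum_nonneg)
    qed
    ultimately have "2 / \<theta> * S \<le> 1" by linarith
    then show "(\<Sum>J\<in>W. weight t J powr s) \<le> \<theta> / 2"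
      using \<theta>(1) by (simp add: S_def field_simps)
  qed auto
  then have "\<forall>k. \<exists>J\<in>F.Words. card (pieces J) \<le> M \<and> (\<forall>v\<in>level {..<m} k. f ` K \<inter> F.cyl (J @ v) \<noteq> {})"
    by (metis (no_types, lifting) DiffE mem_Collect_eq not_less)
  then show ?thesis by blast
qed

text \<open>
  The at most \<open>M\<close> pieces carry the trace of \<open>f ` K\<close> on \<open>F.cyl J\<close>. They are similar to \<open>K\<close>, as are
  the cylinders of generation \<open>M\<close>, of which there are at least \<open>M\<close>; so the latter can be mapped
  onto the former. Blowing up \<open>F.cyl J\<close> to \<open>F\<close> makes up for the contraction, and the resulting
  Lipschitz constant does not depend on \<open>J\<close>.
\<close>

lemma ex_rescaled_map:
  assumes J: "J \<in> F.Words" and M: "card (pieces J) \<le> M" and ne: "f ` K \<inter> F.cyl J \<noteq> {}"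
  shows "\<exists>G. ((L * diameter K * scale + diameter F) / K.rmin ^ M / K.gap)-lipschitz_on K G \<and> G ` K \<subseteq> F \<and>
    (\<forall>v. f ` K \<inter> F.cyl (J @ v) \<noteq> {} \<longrightarrow> v \<in> F.Words \<longrightarrow> G ` K \<inter> F.cyl v \<noteq> {})"
proof -
  note tJ = F.weight_r_pos[OF J]
  have cov: "\<exists>I\<in>pieces J. x \<in> K.cyl I" if x: "x \<in> K" "f x \<in> F.cyl J" for x
  proof -
    obtain I where "I \<in> K.cut (scale * weight t J)" "x \<in> K.cyl I"
      using K.ex_cut_cyl[OF mult_pos_pos[OF scale(1) tJ] x(1)] by blast
    with x show ?thesis by (auto simp: pieces_def)
  qed
  obtain I0 where I0: "I0 \<in> pieces J" using ne cov by blast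
  have "card (pieces J) \<le> card (level {..<n} M)"
  proof -
    have "M \<le> 2 ^ M" by simp
    also have "(2::nat) ^ M \<le> n ^ M" using K.two_maps by (rule power_mono) simp
    also have "n ^ M = card (level {..<n} M)"
      using card_lists_length_eq[of "{..<n}" M] by (simp add: level_def lists_eq_set)
    finally show ?thesis using M by simp
  qed
  then obtain e where e: "e ` pieces J \<subseteq> level {..<n} M" "inj_on e (pieces J)"
    using card_le_inj[OF finite_pieces[OF J] finite_level[of "{..<n}" M]] by blast
  define \<sigma> where "\<sigma> w = (if w \<in> e ` pieces J then inv_into (pieces J) e w else I0)" for w
  have \<sigma>: "\<sigma> w \<in> pieces J" for w
    using I0 by (auto simp: \<sigma>_def inv_into_into)
  have \<sigma>e: "\<sigma> (e I) = I" if "I \<in> pieces J" for I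
    using that e(2) by (simp add: \<sigma>_def)
  (* The word of the cylinder of generation M around x; G maps this cylinder to its piece of K by the
     similarity between the two, then to F.cyl J by f, and blows up the result. *)
  define code where "code x = (SOME w. w \<in> level {..<n} M \<and> x \<in> K.cyl w)" for x
  have code: "code x = w" if w: "w \<in> level {..<n} M" "x \<in> K.cyl w" for x w
  proof -
    have p: "code x \<in> level {..<n} M \<and> x \<in> K.cyl (code x)"
      unfolding code_def by (rule someI[of _ w]) (use w in blast)
    then have "prefix (code x) w \<or> prefix w (code x)"
      using K.cyl_meet_prefix[of "code x" w x] w by (simp add: level_def)
    moreover have "length (code x) = length w"
      using p w(1) by (simp add: level_def)
    ultimately show ?thesis
      by (auto elim: prefixE)
  qed
  define G where
    "G x = inv (foldr \<psi> J) (f (foldr \<phi> (\<sigma> (code x)) (inv (foldr \<phi> (code x)) x)))" for x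
  have G: "G (foldr \<phi> w a) \<in> F" "foldr \<psi> J (G (foldr \<phi> w a)) = f (foldr \<phi> (\<sigma> w) a)"
    if w: "w \<in> level {..<n} M" and a: "a \<in> K" for w a
  proof -
    have wW: "w \<in> K.Words" using w by (simp add: level_def)
    have "code (foldr \<phi> w a) = w"
      using a by (intro code[OF w]) (simp add: K.cyl_def)
    then have Gx: "G (foldr \<phi> w a) = inv (foldr \<psi> J) (f (foldr \<phi> (\<sigma> w) a))"
      using K.inj_word[OF wW] by (simp add: G_def)
    have "f (foldr \<phi> (\<sigma> w) a) \<in> F.cyl J"
      using pieces_image[OF J \<sigma>[of w]] a by (auto simp: K.cyl_def)
    then obtain b where b: "b \<in> F" "f (foldr \<phi> (\<sigma> w) a) = foldr \<psi> J b"
      by (auto simp: F.cyl_def)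
    then have "G (foldr \<phi> w a) = b"
      using Gx F.inj_word[OF J] by simp
    with b show "G (foldr \<phi> w a) \<in> F" "foldr \<psi> J (G (foldr \<phi> w a)) = f (foldr \<phi> (\<sigma> w) a)"
      by simp_all
  qed
  have decomp: "\<exists>w\<in>level {..<n} M. \<exists>a\<in>K. x = foldr \<phi> w a" if "x \<in> K" for x
    using K.cyl_extension[of x "[]" M] that by (auto simp: K.cyl_def)
  have GF: "G ` K \<subseteq> F"
    using decomp G(1) by blast
  have "((L * diameter K * scale + diameter F) / K.rmin ^ M / K.gap)-lipschitz_on K G"
  proof (rule K.lipschitz_onI_cyl)
    note nn = L_nonneg K.diameter_K_nonneg F.diameter_K_nonneg scale(1)
    have rm: "0 < K.rmin ^ M" using K.rmin(1) by simp
    show "0 \<le> (L * diameter K * scale + diameter F) / K.rmin ^ M"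
      using nn rm by simp
    fix v x y assume v: "v \<in> K.Words" "x \<in> K.cyl v" "y \<in> K.cyl v"
    note rv = K.weight_r_pos[OF v(1)]
    show "dist (G x) (G y) \<le> (L * diameter K * scale + diameter F) / K.rmin ^ M * weight r v"
    (* Only cylinders inside a single cylinder of generation M need the estimate for f; the larger ones
       have a ratio bounded below, and the diameter of F suffices. *)
    proof (cases "M \<le> length v")
      case True
      define w u where "w = take M v" and "u = drop M v"
      have vwu: "v = w @ u" by (simp add: w_def u_def)
      have wW: "w \<in> K.Words" "u \<in> K.Words" using v(1) unfolding vwu by auto
      have lw: "length w = M" using True by (simp add: w_def)
      then have w: "w \<in> level {..<n} M" using wW by (simp add: level_def)
      obtain a b where a: "a \<in> K.cyl u" "x = foldr \<phi> w a" and b: "b \<in> K.cyl u" "y = foldr \<phi> w b"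
        using v(2,3) unfolding vwu K.cyl_append by blast
      have abK: "a \<in> K" "b \<in> K" using a b K.cyl_subset_K[OF wW(2)] by auto
      define I where "I = \<sigma> w"
      have I: "I \<in> K.Words" using pieces_Words[OF \<sigma>] by (simp add: I_def)
      have IK: "foldr \<phi> I a \<in> K" "foldr \<phi> I b \<in> K"
        using K.cyl_subset_K[OF I] abK by (auto simp: K.cyl_def)
      have "weight t J * dist (G x) (G y) = dist (f (foldr \<phi> I a)) (f (foldr \<phi> I b))"
        using F.dist_word[OF J, of "G x" "G y"] G(2)[OF w] abK a b by (simp add: I_def)
      also have "\<dots> \<le> L * dist (foldr \<phi> I a) (foldr \<phi> I b)"
        by (rule lipschitz_onD[OF lipschitz IK])
      also have "\<dots> = L * (weight r I * dist a b)"
        by (simp add: K.dist_word[OF I])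
      also have "\<dots> \<le> L * ((scale * weight t J) * (weight r u * diameter K))"
        using pieces_weight[OF \<sigma>[of w]] K.dist_cyl_le[OF wW(2) a(1) b(1)] K.weight_r_pos[OF I] nn tJ
        by (intro mult_left_mono mult_mono) (auto simp: I_def)
      also have "\<dots> = weight t J * (L * diameter K * scale * weight r u)" by simp
      finally have "dist (G x) (G y) \<le> L * diameter K * scale * weight r u"
        using tJ by simp
      also have "\<dots> \<le> (L * diameter K * scale + diameter F) * weight r u"
        using nn K.weight_r_pos[OF wW(2)] by (intro mult_right_mono) auto
      also have "\<dots> \<le> (L * diameter K * scale + diameter F) * (weight r v / K.rmin ^ M)"
        using nn K.weight_r_ge[OF wW(1)] K.weight_r_pos[OF wW(2)] rm lw
        by (intro mult_left_mono) (auto simp: vwu pos_le_divide_eq mult.commute)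
      finally show ?thesis by simp
    next
      case False
      have "x \<in> K" "y \<in> K" using v K.cyl_subset_K by auto
      then have "dist (G x) (G y) \<le> diameter F"
        using GF by (intro diameter_bounded_bound[OF compact_imp_bounded[OF F.K_compact]]) auto
      also have "\<dots> \<le> (L * diameter K * scale + diameter F) * 1"
        using nn by simp
      also have "\<dots> \<le> (L * diameter K * scale + diameter F) * (weight r v / K.rmin ^ M)"
      proof (rule mult_left_mono)
        have "K.rmin ^ M \<le> K.rmin ^ length v"
          using False K.rmin by (intro power_decreasing) auto
        then show "1 \<le> weight r v / K.rmin ^ M"
          using K.weight_r_ge[OF v(1)] rm by (simp add: pos_le_divide_eq)
      qed (use nn in simp)
      finally show ?thesis by simp
    qed
  qed
  moreover have "G ` K \<inter> F.cyl v \<noteq> {}" if v: "f ` K \<inter> F.cyl (J @ v) \<noteq> {}" "v \<in> F.Words" for v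
  proof -
    obtain x where x: "x \<in> K" "f x \<in> F.cyl (J @ v)" using v(1) by blast
    then obtain I where I: "I \<in> pieces J" "x \<in> K.cyl I"
      using cov F.cyl_append_subset[OF v(2)] by blast
    obtain a where a: "a \<in> K" "x = foldr \<phi> I a" using I(2) by (auto simp: K.cyl_def)
    obtain z where z: "z \<in> F.cyl v" "f x = foldr \<psi> J z" using x(2) by (auto simp: F.cyl_append)
    have eI: "e I \<in> level {..<n} M" using e(1) I(1) by blast
    have "foldr \<psi> J (G (foldr \<phi> (e I) a)) = foldr \<psi> J z"
      using G(2)[OF eI a(1)] \<sigma>e[OF I(1)] a(2) z(2) by simp
    then have "G (foldr \<phi> (e I) a) = z"
      by (rule injD[OF F.inj_word[OF J]])
    moreover have "foldr \<phi> (e I) a \<in> K"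
      using K.cyl_subset_K[of "e I"] eI a(1) by (auto simp: K.cyl_def level_def)
    ultimately show ?thesis using z(1) by blast
  qed
  ultimately show ?thesis using GF by blast
qed

lemma ex_equi_lipschitz_nearly_onto:
  "\<exists>\<Lambda>. \<forall>k. \<exists>G. \<Lambda>-lipschitz_on K G \<and> G ` K \<subseteq> F \<and> (\<forall>v\<in>level {..<m} k. G ` K \<inter> F.cyl v \<noteq> {})"
proof -
  obtain M where M: "\<forall>k. \<exists>J\<in>F.Words. card (pieces J) \<le> M \<and> (\<forall>v\<in>level {..<m} k. f ` K \<inter> F.cyl (J @ v) \<noteq> {})"
    using ex_uncrowded_cyl_with_dense_trace by blast
  define \<Lambda> where "\<Lambda> = (L * diameter K * scale + diameter F) / K.rmin ^ M / K.gap"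
  have "\<exists>G. \<Lambda>-lipschitz_on K G \<and> G ` K \<subseteq> F \<and> (\<forall>v\<in>level {..<m} k. G ` K \<inter> F.cyl v \<noteq> {})" for k
  proof -
    obtain J where J: "J \<in> F.Words" "card (pieces J) \<le> M"
        "\<forall>v\<in>level {..<m} k. f ` K \<inter> F.cyl (J @ v) \<noteq> {}"
      using M[rule_format, of k] by (elim bexE conjE)
    have lev: "v \<in> F.Words" if "v \<in> level {..<m} k" for v
      using that by (simp add: level_def)
    obtain y where "y \<in> F" using F.K_nonempty by blast
    then obtain v where v: "v \<in> level {..<m} k"
      using F.cyl_extension[of y "[]" k] by auto
    have "f ` K \<inter> F.cyl J \<noteq> {}"
      using bspec[OF J(3) v] F.cyl_append_subset[OF lev[OF v], of J] by auto
    then obtain G where G: "\<Lambda>-lipschitz_on K G" "G ` K \<subseteq> F"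
        "\<forall>v. f ` K \<inter> F.cyl (J @ v) \<noteq> {} \<longrightarrow> v \<in> F.Words \<longrightarrow> G ` K \<inter> F.cyl v \<noteq> {}"
      using ex_rescaled_map[OF J(1,2), folded \<Lambda>_def] by metis
    moreover from G(3) J(3) lev have "\<forall>v\<in>level {..<m} k. G ` K \<inter> F.cyl v \<noteq> {}"
      by metis
    ultimately show ?thesis by metis
  qed
  then show ?thesis by blast
qed

end

section \<open>Passing to the limit\<close>

text \<open>
  A point of \<open>F\<close> lies, for every \<open>k\<close>, in some cylinder of generation \<open>k\<close> and thus close to the image
  of the \<open>k\<close>-th map; so it is in the closure of the image of the limit, which is compact.
\<close>

lemma lipschitz_onto_limit:
  fixes X :: "'a::euclidean_space set" and F :: "'b::euclidean_space set"
  assumes F: "dust_like_ifs m \<psi> t F" and X: "compact X"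
    and G: "\<And>k. \<exists>G. \<Lambda>-lipschitz_on X G \<and> G ` X \<subseteq> F \<and>
      (\<forall>v\<in>level {..<m} k. G ` X \<inter> dust_like_ifs.cyl \<psi> F v \<noteq> {})"
  shows "\<exists>g. \<Lambda>-lipschitz_on X g \<and> g ` X = F"
proof -
  interpret F: dust_like_ifs m \<psi> t F by (rule F)
  obtain G where G: "\<And>k. \<Lambda>-lipschitz_on X (G k)" "\<And>k. G k ` X \<subseteq> F"
      "\<And>k v. v \<in> level {..<m} k \<Longrightarrow> G k ` X \<inter> F.cyl v \<noteq> {}"
    using G by metis
  have \<Lambda>: "0 \<le> \<Lambda>" using G(1) by (rule lipschitz_on_nonneg)
  obtain b where b: "\<And>y. y \<in> F \<Longrightarrow> norm y \<le> b"
    using compact_imp_bounded[OF F.K_compact] unfolding bounded_iff by blast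
  obtain g :: "'a \<Rightarrow> 'b" and k :: "nat \<Rightarrow> nat" where g: "continuous_on X g" and k: "strict_mono k"
    and lim: "\<And>e. 0 < e \<Longrightarrow> \<exists>N. \<forall>j x. N \<le> j \<and> x \<in> X \<longrightarrow> norm (G (k j) x - g x) < e"
  proof (rule Arzela_Ascoli[OF X, of G b])
    show "norm (G j x) \<le> b" if "x \<in> X" for j x
      using G(2) b that by blast
    show "\<exists>d>0. \<forall>j y. y \<in> X \<and> norm (x - y) < d \<longrightarrow> norm (G j x - G j y) < e"
      if x: "x \<in> X" and e: "0 < e" for x e
    proof (intro exI[of _ "e / (\<Lambda> + 1)"] conjI allI impI)
      show "0 < e / (\<Lambda> + 1)" using e \<Lambda> by simp
      fix j y assume y: "y \<in> X \<and> norm (x - y) < e / (\<Lambda> + 1)"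
      have "norm (G j x - G j y) \<le> \<Lambda> * norm (x - y)"
        using lipschitz_on_normD[OF G(1) x] y by blast
      also have "\<dots> \<le> (\<Lambda> + 1) * norm (x - y)"
        by (intro mult_right_mono) auto
      also have "\<dots> < e"
        using y \<Lambda> by (simp add: pos_less_divide_eq mult.commute)
      finally show "norm (G j x - G j y) < e" .
    qed
  qed blast
  have ptw: "(\<lambda>j. G (k j) x) \<longlonglongrightarrow> g x" if "x \<in> X" for x
    unfolding LIMSEQ_iff using lim that by blast
  have lip: "\<Lambda>-lipschitz_on X g"
  proof (rule lipschitz_onI[OF _ \<Lambda>])
    fix x y assume xy: "x \<in> X" "y \<in> X"
    have "(\<lambda>j. dist (G (k j) x) (G (k j) y)) \<longlonglongrightarrow> dist (g x) (g y)"
      by (intro tendsto_dist ptw xy)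
    then show "dist (g x) (g y) \<le> \<Lambda> * dist x y"
      by (rule LIMSEQ_le_const2) (use lipschitz_onD[OF G(1) xy] in blast)
  qed
  have sub: "g ` X \<subseteq> F"
  proof (intro image_subsetI)
    fix x assume x: "x \<in> X"
    show "g x \<in> F"
      by (rule closed_sequentially[OF compact_imp_closed[OF F.K_compact] _ ptw[OF x]]) (use G(2) x in blast)
  qed
  have "F \<subseteq> g ` X"
  proof
    fix y assume y: "y \<in> F"
    have "\<exists>z\<in>g ` X. dist z y < e" if e: "0 < e" for e
    proof -
      obtain q where q: "F.rmax ^ q < e / (2 * (diameter F + 1))"
        using F.rmax_power_small[of "e / (2 * (diameter F + 1))"] e F.diameter_K_nonneg by auto
      obtain N where N: "\<And>j x. N \<le> j \<Longrightarrow> x \<in> X \<Longrightarrow> norm (G (k j) x - g x) < e / 2"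
        using lim[of "e / 2"] e by auto
      define j where "j = max N q"
      have qk: "q \<le> k j"
        using seq_suble[OF k, of j] by (simp add: j_def)
      obtain v where v: "v \<in> level {..<m} (k j)" "y \<in> F.cyl v"
        using F.cyl_extension[of y "[]" "k j"] y by auto
      then obtain x where x: "x \<in> X" "G (k j) x \<in> F.cyl v"
        using G(3) by blast
      have vW: "v \<in> F.Words" "length v = k j" using v by (auto simp: level_def)
      have "dist (G (k j) x) y \<le> weight t v * diameter F"
        by (rule F.dist_cyl_le[OF vW(1) x(2) v(2)])
      also have "\<dots> \<le> F.rmax ^ q * (diameter F + 1)"
      proof (rule mult_mono)
        have "F.rmax ^ k j \<le> F.rmax ^ q"
          using F.rmax qk by (intro power_decreasing) auto
        then show "weight t v \<le> F.rmax ^ q" using F.weight_r_le[OF vW(1)] vW(2) by simp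
      qed (use F.rmax F.diameter_K_nonneg in auto)
      also have "\<dots> < e / 2"
        using q F.diameter_K_nonneg by (simp add: field_simps)
      finally have "dist (G (k j) x) y < e / 2" .
      moreover have "dist (g x) (G (k j) x) < e / 2"
        using N[of j x] x(1) by (simp add: j_def dist_norm norm_minus_commute)
      ultimately have "dist (g x) y < e"
        using dist_triangle[of "g x" y "G (k j) x"] by linarith
      with x(1) show ?thesis by blast
    qed
    then have "y \<in> closure (g ` X)"
      by (simp add: closure_approachable)
    moreover have "closed (g ` X)"
      by (intro compact_imp_closed compact_continuous_image g X)
    ultimately show "y \<in> g ` X" by simp
  qed
  with lip sub show ?thesis by blast
qed

lemma hausdorff_measure_empty:
  assumes "0 < s"
  shows "hausdorff_measure s {} = 0"
proof -
  have "hausdorff_premeasure s \<delta> ({} :: 'a set) \<le> 0" if "0 < \<delta>" for \<delta>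
    using hausdorff_premeasure_le_finite_cover[of s \<delta> "{}" "{}" "\<lambda>_. {}"] assms that by simp
  then have "hausdorff_measure s ({} :: 'a set) \<le> 0"
    unfolding hausdorff_measure_def by (intro SUP_least) simp
  then show ?thesis by simp
qed

theorem theorem1p3:
  fixes K F :: "(real ^ 'd) set" and s :: real and f :: "real ^ 'd \<Rightarrow> real ^ 'd"
  assumes "dust_like K" and "dust_like F"
    and "hausdorff_dim K = ereal s" and "hausdorff_dim F = ereal s"
    and "\<exists>L. L-lipschitz_on K f"
    and "hausdorff_measure s (f ` K \<inter> F) > 0"
  shows "\<exists>g :: real ^ 'd \<Rightarrow> real ^ 'd. (\<exists>L. L-lipschitz_on K g) \<and> g ` K = F"
proof -
  obtain n \<phi> r where "dust_like_ifs n \<phi> r K" using assms(1) by (rule dust_likeE)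
  then interpret K: dust_like_ifs n \<phi> r K .
  obtain m \<psi> t where F: "dust_like_ifs m \<psi> t F" using assms(2) by (rule dust_likeE)
  then interpret F: dust_like_ifs m \<psi> t F .
  obtain L where L: "L-lipschitz_on K f" using assms(5) by blast
  have sums: "(\<Sum>i<n. r i powr s) \<le> 1" "(\<Sum>i<m. t i powr s) \<le> 1"
    using K.sum_ratio_powr_dim_le_1 F.sum_ratio_powr_dim_le_1 assms(3,4) by auto
  have s0: "0 < s" using K.dim_pos[OF sums(1)] .
  (* After a retraction onto the preimage of F, the map takes all its values in F. *)
  define C where "C = K \<inter> f -` F"
  have "closed C"
    unfolding C_def
    by (intro continuous_closed_preimage lipschitz_on_continuous_on[OF L] compact_imp_closed K.K_compact F.K_compact)
  moreover have fC: "f ` C = f ` K \<inter> F" by (auto simp: C_def)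
  then have "C \<noteq> {}"
    using assms(6)[folded fC] hausdorff_measure_empty[OF s0] by (metis image_is_empty less_irrefl)
  ultimately obtain h L' where h: "L'-lipschitz_on K h" "h ` K = C"
    using K.ex_lipschitz_retraction[of C] by (auto simp: C_def)
  have "(L * L')-lipschitz_on K (f \<circ> h)"
    by (rule lipschitz_on_compose[OF h(1)]) (use L h(2) in \<open>auto simp: C_def intro: lipschitz_on_subset\<close>)
  moreover have "(f \<circ> h) ` K = f ` K \<inter> F"
    using h(2) fC by (metis image_comp)
  ultimately interpret lipschitz_between_dusts n \<phi> r K m \<psi> t F "f \<circ> h" "L * L'" s
    using sums assms(6) by unfold_locales auto
  obtain \<Lambda> where "\<forall>k. \<exists>G. \<Lambda>-lipschitz_on K G \<and> G ` K \<subseteq> F \<and> (\<forall>v\<in>level {..<m} k. G ` K \<inter> F.cyl v \<noteq> {})"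
    using ex_equi_lipschitz_nearly_onto by blast
  then have "\<exists>g. \<Lambda>-lipschitz_on K g \<and> g ` K = F"
    by (intro lipschitz_onto_limit[OF F K.K_compact]) (rule spec)
  then show ?thesis by blast
qed

end
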